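(* Let $G$ be a finite group. Then $\mathcal{V}_\omega(\mathbb{Z}G)=\{1\}$ if and only if either (i) $G$ is an abelian group of exponent $6$; or (ii) $G$ is a $p$-group for some prime $p$.
   Context: For a group $G$, $\mathbb{Z}G$ is the integral group ring, $\Delta(G)$ is its augmentation ideal, and $\Delta^n(G)$ is the $n$-th power of this ideal. $\mathcal{V}(\mathbb{Z}G)$ is the group of units of augmentation one in $\mathbb{Z}G$; for $n\ge 1$, $\mathcal{V}_n(\mathbb{Z}G)=\mathcal{V}(\mathbb{Z}G)\cap(1+\Delta^n(G))$; and $\mathcal{V}_\omega(\mathbb{Z}G)=\bigcap_{n=1}^\infty\mathcal{V}_n(\mathbb{Z}G)$ (the $\Delta$-adic residue of $\mathcal{V}(\mathbb{Z}G)$). *)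

theory Defs
  imports "HOL-Algebra.Algebra"
begin

text \<open>Multiplication in $\mathbb{Z}G$ is the $\mathbb{Z}$-bilinear extension of the multiplication
  of \<open>G\<close>; the keys (the support) are restricted to \<open>carrier G\<close>.\<close>

definition group_ring :: "('a, 'b) monoid_scheme \<Rightarrow> ('a \<Rightarrow>\<^sub>0 int) ring" where
  "group_ring G =
     \<lparr>carrier = {a. Poly_Mapping.keys a \<subseteq> carrier G},
      monoid.mult = (\<lambda>a b. frag_extend (\<lambda>x. frag_extend (\<lambda>y. frag_of (x \<otimes>\<^bsub>G\<^esub> y)) b) a),
      one = frag_of \<one>\<^bsub>G\<^esub>,
      ring.zero = 0,
      add = (+)\<rparr>"

definition augmentation :: "('a \<Rightarrow>\<^sub>0 int) \<Rightarrow> int" where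
  "augmentation a = (\<Sum>x\<in>Poly_Mapping.keys a. Poly_Mapping.lookup a x)"

definition augmentation_ideal :: "('a, 'b) monoid_scheme \<Rightarrow> ('a \<Rightarrow>\<^sub>0 int) set" where
  "augmentation_ideal G = a_kernel (group_ring G) \<Z> augmentation"

primrec ideal_power :: "('a, 'b) ring_scheme \<Rightarrow> 'a set \<Rightarrow> nat \<Rightarrow> 'a set" where
  "ideal_power R I 0 = carrier R"
| "ideal_power R I (Suc n) = ideal_prod R (ideal_power R I n) I"

definition normalized_units :: "('a, 'b) monoid_scheme \<Rightarrow> ('a \<Rightarrow>\<^sub>0 int) set" where
  "normalized_units G = {u \<in> Units (group_ring G). augmentation u = 1}"

definition normalized_units_level :: "('a, 'b) monoid_scheme \<Rightarrow> nat \<Rightarrow> ('a \<Rightarrow>\<^sub>0 int) set" where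
  "normalized_units_level G n =
     normalized_units G \<inter>
     (\<one>\<^bsub>group_ring G\<^esub> <+\<^bsub>group_ring G\<^esub> ideal_power (group_ring G) (augmentation_ideal G) n)"

definition delta_adic_residue :: "('a, 'b) monoid_scheme \<Rightarrow> ('a \<Rightarrow>\<^sub>0 int) set" where
  "delta_adic_residue G = (\<Inter>n\<in>{1..}. normalized_units_level G n)"

text \<open>The value is only meaningful if some positive \<open>n\<close> annihilates \<open>G\<close>, e.g. if \<open>G\<close> is finite.\<close>

definition group_exponent :: "('a, 'b) monoid_scheme \<Rightarrow> nat" where
  "group_exponent G = (LEAST n. n > 0 \<and> (\<forall>x\<in>carrier G. x [^]\<^bsub>G\<^esub> n = \<one>\<^bsub>G\<^esub>))"

text \<open>Used for prime \<open>p\<close> only. The trivial group is a \<open>p\<close>-group for every prime \<open>p\<close>. Elements of infinite order have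
  \<open>ord = 0\<close>, which is not a power of a prime.\<close>

definition p_group :: "nat \<Rightarrow> ('a, 'b) monoid_scheme \<Rightarrow> bool" where
  "p_group p G \<longleftrightarrow> group G \<and> (\<forall>x\<in>carrier G. \<exists>k. group.ord G x = p ^ k)"


lemma group_ring_simps [simp]:
  "carrier (group_ring G) = {a. Poly_Mapping.keys a \<subseteq> carrier G}"
  "a \<otimes>\<^bsub>group_ring G\<^esub> b = frag_extend (\<lambda>x. frag_extend (\<lambda>y. frag_of (x \<otimes>\<^bsub>G\<^esub> y)) b) a"
  "\<one>\<^bsub>group_ring G\<^esub> = frag_of \<one>\<^bsub>G\<^esub>"
  "\<zero>\<^bsub>group_ring G\<^esub> = 0"
  "a \<oplus>\<^bsub>group_ring G\<^esub> b = a + b"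
  by (simp_all add: group_ring_def)

lemma frag_extend_add_fun:
  "frag_extend (\<lambda>x. f x + g x) a = frag_extend f a + frag_extend g a"
  by (simp add: frag_extend_def frag_cmul_distrib2 sum.distrib)

lemma (in group) ring_group_ring: "ring (group_ring G)"
proof (rule ringI)
  show "abelian_group (group_ring G)"
  proof (rule abelian_groupI)
    fix x y assume "x \<in> carrier (group_ring G)" "y \<in> carrier (group_ring G)"
    then show "x \<oplus>\<^bsub>group_ring G\<^esub> y \<in> carrier (group_ring G)"
      using keys_add[of x y] by auto
  next
    fix x assume "x \<in> carrier (group_ring G)"
    then show "\<exists>y\<in>carrier (group_ring G). y \<oplus>\<^bsub>group_ring G\<^esub> x = \<zero>\<^bsub>group_ring G\<^esub>"
      by (intro bexI[of _ "- x"]) auto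
  qed (auto simp: algebra_simps)
  show "Group.monoid (group_ring G)"
  proof
    fix a b assume ab: "a \<in> carrier (group_ring G)" "b \<in> carrier (group_ring G)"
    then show "a \<otimes>\<^bsub>group_ring G\<^esub> b \<in> carrier (group_ring G)"
      by (fastforce dest!: keys_frag_extend[THEN subsetD] split: if_splits)
  next
    fix a b c
    assume "a \<in> carrier (group_ring G)" "b \<in> carrier (group_ring G)" "c \<in> carrier (group_ring G)"
    then have a: "Poly_Mapping.keys a \<subseteq> carrier G" and b: "Poly_Mapping.keys b \<subseteq> carrier G"
      and c: "Poly_Mapping.keys c \<subseteq> carrier G" by auto
    have 1: "frag_extend (\<lambda>z. frag_of (x \<otimes> y \<otimes> z)) c =
        frag_extend (\<lambda>z. frag_of (x \<otimes> z)) (frag_extend (\<lambda>z. frag_of (y \<otimes> z)) c)"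
      if "x \<in> carrier G" "y \<in> carrier G" for x y
      using c by (induction c rule: frag_induction) (auto simp: frag_extend_diff m_assoc that)
    have 2: "frag_extend (\<lambda>w. frag_extend (\<lambda>z. frag_of (w \<otimes> z)) c) (frag_extend (\<lambda>y. frag_of (x \<otimes> y)) b) =
        frag_extend (\<lambda>w. frag_of (x \<otimes> w)) (frag_extend (\<lambda>y. frag_extend (\<lambda>z. frag_of (y \<otimes> z)) c) b)"
      if "x \<in> carrier G" for x
      using b by (induction b rule: frag_induction) (auto simp: frag_extend_diff 1 that)
    show "a \<otimes>\<^bsub>group_ring G\<^esub> b \<otimes>\<^bsub>group_ring G\<^esub> c = a \<otimes>\<^bsub>group_ring G\<^esub> (b \<otimes>\<^bsub>group_ring G\<^esub> c)"
      using a by (induction a rule: frag_induction) (auto simp: frag_extend_diff 2)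
  next
    fix a assume "a \<in> carrier (group_ring G)"
    then have a: "Poly_Mapping.keys a \<subseteq> carrier G" by simp
    show "\<one>\<^bsub>group_ring G\<^esub> \<otimes>\<^bsub>group_ring G\<^esub> a = a"
      using a by (induction a rule: frag_induction) (auto simp: frag_extend_diff)
    show "a \<otimes>\<^bsub>group_ring G\<^esub> \<one>\<^bsub>group_ring G\<^esub> = a"
      using a by (induction a rule: frag_induction) (auto simp: frag_extend_diff)
  qed auto
qed (auto simp: frag_extend_add frag_extend_add_fun)

lemma augmentation_superset:
  assumes "finite S" "Poly_Mapping.keys a \<subseteq> S"
  shows "augmentation a = (\<Sum>x\<in>S. Poly_Mapping.lookup a x)"
  unfolding augmentation_def using assms
  by (intro sum.mono_neutral_left) (auto simp: in_keys_iff)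

lemma augmentation_frag_of [simp]: "augmentation (frag_of x) = 1"
  by (simp add: augmentation_def)

lemma augmentation_zero [simp]: "augmentation 0 = 0"
  by (simp add: augmentation_def)

lemma augmentation_diff: "augmentation (a - b) = augmentation a - augmentation b"
  by (subst (1 2 3) augmentation_superset[of "Poly_Mapping.keys a \<union> Poly_Mapping.keys b"])
     (auto simp: keys_diff lookup_minus sum_subtractf)

lemma augmentation_add: "augmentation (a + b) = augmentation a + augmentation b"
  using augmentation_diff[of "a + b" b] by simp

lemma (in group) augmentation_ring_hom: "augmentation \<in> ring_hom (group_ring G) \<Z>"
proof (rule ring_hom_memI)
  fix a b assume "a \<in> carrier (group_ring G)" "b \<in> carrier (group_ring G)"
  have *: "augmentation (frag_extend (\<lambda>y. frag_of (x \<otimes> y)) b) = augmentation b" for x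
    using subset_UNIV[of "Poly_Mapping.keys b"]
    by (induction b rule: frag_induction) (auto simp: frag_extend_diff augmentation_diff)
  show "augmentation (a \<otimes>\<^bsub>group_ring G\<^esub> b) = augmentation a \<otimes>\<^bsub>\<Z>\<^esub> augmentation b"
    using subset_UNIV[of "Poly_Mapping.keys a"]
    by (induction a rule: frag_induction) (auto simp: frag_extend_diff augmentation_diff algebra_simps *)
qed (auto simp: augmentation_add)

lemma (in group) ideal_augmentation_ideal: "ideal (augmentation_ideal G) (group_ring G)"
  unfolding augmentation_ideal_def
  by (intro ring_hom_ring.kernel_is_ideal ring_hom_ringI2 ring_group_ring augmentation_ring_hom
      cring.axioms(1)[OF int_is_cring])

end

theory Submission
  imports Defs "HOL-Number_Theory.Residues" "HOL-Computational_Algebra.Polynomial"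
begin

text \<open>Write \<open>\<Delta>\<close> for the augmentation ideal. The theorem rests on one observation: if \<open>a\<close> and \<open>b\<close>
  have coprime orders \<open>m\<close> and \<open>k\<close>, then \<open>(a - 1)(b - 1)\<close> lies in every power of \<open>\<Delta>\<close>, since high powers of
  \<open>m\<close> and of \<open>k\<close> both multiply it into a given power
  (\<open>coprime_torsion_mult_mem_\<Delta>\<close>). Every unit congruent to \<open>1\<close> modulo multiples of such products is in the residue.

  Suppose the residue is trivial. Elements of coprime order commute, since their commutator is in the
  residue (\<open>coprime_torsion_commute\<close>). If \<open>G\<close> is not a \<open>p\<close>-group, there are elements of two
  different prime orders, and two families of units become available. For \<open>x\<close> of order \<open>mk\<close> with coprime
  \<open>m, k \<ge> 2\<close>, the element \<open>1 - x\<close> is invertible modulo the annihilator of \<open>(x\<^sup>k - 1)(x\<^sup>m - 1)\<close>, and one of its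
  powers acts on that product as a unit in the residue; this unit differs from \<open>1\<close> as soon as
  \<open>0 < \<bar>1 - \<zeta>\<bar> < 1\<close> for some primitive \<open>mk\<close>-th root of unity \<open>\<zeta>\<close>, that is, unless \<open>mk = 6\<close>
  (\<open>nontrivial_residue_of_cyclic\<close>). Hence the order of every element divides \<open>6\<close>. For elements \<open>x, y\<close> of the same prime
  order and \<open>z\<close> of another one, the bicyclic unit \<open>1 + (z - 1)(x - 1) y (1 + x + x\<^sup>2 + \<dots>)\<close> is in
  the residue, and it is trivial only if \<open>x\<close> and \<open>y\<close> commute (\<open>same_prime_torsion_commute\<close>). Hence
  \<open>G\<close> is abelian of exponent \<open>6\<close>.

  Conversely, for a \<open>p\<close>-group \<open>G\<close> the action on \<open>\<int>G / p\<int>G\<close> is unipotent, so some power of \<open>\<Delta>\<close> lies in \<open>p\<int>G\<close> and the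
  intersection of all powers is zero (\<open>p_group_residue_trivial\<close>). For abelian \<open>G\<close> of exponent
  \<open>6\<close> this intersection is not zero, and the argument has to use that \<open>u\<close> is a unit: characters take
  values in the Eisenstein integers, \<open>\<chi>(u)\<close> has absolute value \<open>1\<close>, and \<open>\<chi>(u) - 1\<close> is divisible by \<open>2\<close> and by
  \<open>1 - \<omega>\<close>, which is possible only for \<open>\<chi>(u) = 1\<close> (\<open>exponent_6_residue_trivial\<close>). Since
  characters separate the elements of \<open>\<int>G\<close>, it follows that \<open>u = 1\<close>.\<close>

section \<open>Arithmetic in the integral group ring\<close>

text \<open>Only the product needs attention, as addition is pointwise. Its definition as a double sum stays folded;
  bilinearity and the values on group elements determine it.\<close>

declare group_ring_simps(1,2) [simp del]

lemma frag_cmul_diff_right: "frag_cmul k (a - b) = frag_cmul k a - frag_cmul k b"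
  by (rule poly_mapping_eqI) (simp add: lookup_minus algebra_simps)

context group
begin

abbreviation ZG :: "('a \<Rightarrow>\<^sub>0 int) ring" where "ZG \<equiv> group_ring G"

abbreviation convolution :: "('a \<Rightarrow>\<^sub>0 int) \<Rightarrow> ('a \<Rightarrow>\<^sub>0 int) \<Rightarrow> ('a \<Rightarrow>\<^sub>0 int)" (infixl \<open>\<star>\<close> 70)
  where "a \<star> b \<equiv> a \<otimes>\<^bsub>group_ring G\<^esub> b"

abbreviation \<Delta> :: "nat \<Rightarrow> ('a \<Rightarrow>\<^sub>0 int) set"
  where "\<Delta> n \<equiv> ideal_power ZG (augmentation_ideal G) n"

lemma mem_ZG_iff: "a \<in> carrier ZG \<longleftrightarrow> Poly_Mapping.keys a \<subseteq> carrier G"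
  by (simp add: group_ring_simps)

lemma frag_of_mem_ZG [simp]: "g \<in> carrier G \<Longrightarrow> frag_of g \<in> carrier ZG"
  by (simp add: mem_ZG_iff)

lemma ZG_zero_closed [simp]: "0 \<in> carrier ZG"
  by (simp add: mem_ZG_iff)

lemma ZG_diff_closed [simp]: "a \<in> carrier ZG \<Longrightarrow> b \<in> carrier ZG \<Longrightarrow> a - b \<in> carrier ZG"
  using keys_diff[of a b] by (auto simp: mem_ZG_iff)

lemma ZG_minus_closed [simp]: "a \<in> carrier ZG \<Longrightarrow> - a \<in> carrier ZG"
  by (simp add: mem_ZG_iff)

lemma ZG_add_closed [simp]: "a \<in> carrier ZG \<Longrightarrow> b \<in> carrier ZG \<Longrightarrow> a + b \<in> carrier ZG"
  using keys_add[of a b] by (auto simp: mem_ZG_iff)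

lemma ZG_cmul_closed [simp]: "a \<in> carrier ZG \<Longrightarrow> frag_cmul c a \<in> carrier ZG"
  using keys_cmul[of c a] by (auto simp: mem_ZG_iff)

lemma ZG_sum_closed: "(\<And>i. i \<in> I \<Longrightarrow> f i \<in> carrier ZG) \<Longrightarrow> sum f I \<in> carrier ZG"
  by (induction I rule: infinite_finite_induct) auto

lemma ZG_mult_closed [simp]: "a \<in> carrier ZG \<Longrightarrow> b \<in> carrier ZG \<Longrightarrow> a \<star> b \<in> carrier ZG"
  by (meson ring.ring_simprules(5) ring_group_ring)

lemma ZG_induct [consumes 1, case_names zero of diff]:
  assumes "a \<in> carrier ZG" "P 0" "\<And>g. g \<in> carrier G \<Longrightarrow> P (frag_of g)"
    "\<And>a b. \<lbrakk>P a; P b\<rbrakk> \<Longrightarrow> P (a - b)"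
  shows "P a"
  using assms frag_induction[of a "carrier G" P] by (auto simp: mem_ZG_iff)

lemma mult_frag_of [simp]: "frag_of g \<star> frag_of h = frag_of (g \<otimes> h)"
  by (simp add: group_ring_simps)

lemma mult_add_left: "(a + b) \<star> c = a \<star> c + b \<star> c"
  by (simp add: group_ring_simps frag_extend_add)

lemma mult_add_right: "c \<star> (a + b) = c \<star> a + c \<star> b"
  by (simp add: group_ring_simps frag_extend_add frag_extend_add_fun)

lemma mult_zero_left [simp]: "0 \<star> c = 0"
  by (simp add: group_ring_simps)

lemma mult_zero_right [simp]: "c \<star> 0 = 0"
  by (simp add: group_ring_simps frag_extend_eq_0)

lemma mult_diff_left: "(a - b) \<star> c = a \<star> c - b \<star> c"
  using mult_add_left[of "a - b" b c] by simp

lemma mult_diff_right: "c \<star> (a - b) = c \<star> a - c \<star> b"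
  using mult_add_right[of c "a - b" b] by simp

lemma mult_minus_left: "(- a) \<star> c = - (a \<star> c)"
  using mult_diff_left[of 0 a c] by simp

lemma mult_minus_right: "c \<star> (- a) = - (c \<star> a)"
  using mult_diff_right[of c 0 a] by simp

lemma mult_cmul_left: "frag_cmul k a \<star> c = frag_cmul k (a \<star> c)"
  by (simp add: group_ring_simps frag_extend_cmul)

lemma mult_cmul_right: "c \<star> frag_cmul k a = frag_cmul k (c \<star> a)"
proof -
  have "frag_extend (\<lambda>x. frag_cmul k (f x)) c = frag_cmul k (frag_extend f c)" for f :: "'a \<Rightarrow> 'a \<Rightarrow>\<^sub>0 int"
    by (simp add: frag_extend_def frag_cmul_sum mult.commute)
  then show ?thesis by (simp add: group_ring_simps frag_extend_cmul)
qed

lemma mult_sum_right: "c \<star> sum f I = (\<Sum>i\<in>I. c \<star> f i)"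
  by (induction I rule: infinite_finite_induct) (auto simp: mult_add_right)

lemma mult_sum_left: "sum f I \<star> c = (\<Sum>i\<in>I. f i \<star> c)"
  by (induction I rule: infinite_finite_induct) (auto simp: mult_add_left)

lemmas mult_distribs = mult_add_left mult_add_right mult_diff_left mult_diff_right
  mult_minus_left mult_minus_right mult_cmul_left mult_cmul_right

lemma mult_one_left [simp]: "a \<in> carrier ZG \<Longrightarrow> frag_of \<one> \<star> a = a"
  using ring.ring_simprules(12)[OF ring_group_ring] by simp

lemma mult_one_right [simp]: "a \<in> carrier ZG \<Longrightarrow> a \<star> frag_of \<one> = a"
  using monoid.r_one[OF ring.is_monoid[OF ring_group_ring]] by simp

lemma mult_assoc:
  "\<lbrakk>a \<in> carrier ZG; b \<in> carrier ZG; c \<in> carrier ZG\<rbrakk> \<Longrightarrow> a \<star> b \<star> c = a \<star> (b \<star> c)"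
  using ring.ring_simprules(11)[OF ring_group_ring] by blast

section \<open>Powers of the augmentation ideal and the residue\<close>

lemma ideal_\<Delta>: "ideal (\<Delta> n) ZG"
proof (induction n)
  case 0
  then show ?case using ring.oneideal[OF ring_group_ring] by simp
next
  case (Suc n)
  then show ?case
    using ring.ideal_prod_is_ideal[OF ring_group_ring] ideal_augmentation_ideal by simp
qed

lemma augmentation_ideal_iff:
  "a \<in> augmentation_ideal G \<longleftrightarrow> a \<in> carrier ZG \<and> augmentation a = 0"
  by (simp add: augmentation_ideal_def a_kernel_def')

lemma frag_of_diff_mem_augmentation_ideal [simp]:
  "g \<in> carrier G \<Longrightarrow> h \<in> carrier G \<Longrightarrow> frag_of g - frag_of h \<in> augmentation_ideal G"
  by (simp add: augmentation_ideal_iff augmentation_diff)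

lemma \<Delta>_carrier: "a \<in> \<Delta> n \<Longrightarrow> a \<in> carrier ZG"
  using ideal.Icarr[OF ideal_\<Delta>] by blast

lemma \<Delta>_mult_left: "a \<in> \<Delta> n \<Longrightarrow> b \<in> carrier ZG \<Longrightarrow> b \<star> a \<in> \<Delta> n"
  using ideal.I_l_closed[OF ideal_\<Delta>] by blast

lemma \<Delta>_mult_right: "a \<in> \<Delta> n \<Longrightarrow> b \<in> carrier ZG \<Longrightarrow> a \<star> b \<in> \<Delta> n"
  using ideal.I_r_closed[OF ideal_\<Delta>] by blast

lemma \<Delta>_zero [simp]: "0 \<in> \<Delta> n"
  using additive_subgroup.zero_closed[OF ideal.axioms(1)[OF ideal_\<Delta>[of n]]] by simp

lemma \<Delta>_add: "a \<in> \<Delta> n \<Longrightarrow> b \<in> \<Delta> n \<Longrightarrow> a + b \<in> \<Delta> n"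
  using additive_subgroup.a_closed[OF ideal.axioms(1)[OF ideal_\<Delta>[of n]]] by simp

lemma \<Delta>_minus: "a \<in> \<Delta> n \<Longrightarrow> - a \<in> \<Delta> n"
  using \<Delta>_mult_left[of a n "- frag_of \<one>"] by (simp add: mult_minus_left \<Delta>_carrier)

lemma \<Delta>_diff: "a \<in> \<Delta> n \<Longrightarrow> b \<in> \<Delta> n \<Longrightarrow> a - b \<in> \<Delta> n"
  using \<Delta>_add[of a n "- b"] \<Delta>_minus by simp

lemma \<Delta>_cmul: "a \<in> \<Delta> n \<Longrightarrow> frag_cmul k a \<in> \<Delta> n"
  using \<Delta>_mult_left[of a n "frag_cmul k (frag_of \<one>)"] by (simp add: mult_cmul_left \<Delta>_carrier)

lemma \<Delta>_Suc_mult: "a \<in> \<Delta> n \<Longrightarrow> b \<in> augmentation_ideal G \<Longrightarrow> a \<star> b \<in> \<Delta> (Suc n)"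
  by (simp add: ideal_prod.prod)

lemma \<Delta>_Suc_induct [consumes 1, case_names mult add]:
  assumes "a \<in> \<Delta> (Suc n)"
    and "\<And>x y. x \<in> \<Delta> n \<Longrightarrow> y \<in> augmentation_ideal G \<Longrightarrow> P (x \<star> y)"
    and "\<And>x y. P x \<Longrightarrow> P y \<Longrightarrow> P (x + y)"
  shows "P a"
proof -
  have "a \<in> ideal_prod ZG (\<Delta> n) (augmentation_ideal G)" using assms(1) by simp
  then show ?thesis
    by (induction rule: ideal_prod.induct) (use assms(2,3) in auto)
qed

lemma \<Delta>_one: "\<Delta> (Suc 0) = augmentation_ideal G"
proof
  show "\<Delta> (Suc 0) \<subseteq> augmentation_ideal G"
    using ring.ideal_prod_inter[OF ring_group_ring ring.oneideal[OF ring_group_ring] ideal_augmentation_ideal]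
    by simp
  show "augmentation_ideal G \<subseteq> \<Delta> (Suc 0)"
    using \<Delta>_Suc_mult[of "frag_of \<one>" 0] by (auto simp: augmentation_ideal_iff)
qed

text \<open>The elements \<open>g - 1\<close> span the augmentation ideal: subtracting \<open>augmentation a\<close> copies of \<open>1\<close>
  from the expansion of \<open>a\<close> changes nothing when \<open>augmentation a = 0\<close>.\<close>

lemma augmentation_ideal_expansion:
  assumes "a \<in> augmentation_ideal G"
  shows "a = (\<Sum>g\<in>Poly_Mapping.keys a. frag_cmul (Poly_Mapping.lookup a g) (frag_of g - frag_of \<one>))"
proof -
  have "(\<Sum>g\<in>K. frag_cmul (f g) (b g - c)) = (\<Sum>g\<in>K. frag_cmul (f g) (b g)) - frag_cmul (sum f K) c"
    for K f and b :: "'a \<Rightarrow> 'a \<Rightarrow>\<^sub>0 int" and c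
    by (induction K rule: infinite_finite_induct) (simp_all add: frag_cmul_distrib frag_cmul_diff_right)
  then show ?thesis
    using assms frag_expansion[of a] by (simp add: augmentation_ideal_iff augmentation_def frag_extend_def)
qed

text \<open>Augmentation one is implied by the congruence modulo \<open>\<Delta> 1\<close>, and the level \<open>n = 0\<close>, which the
  definition leaves out, imposes no condition.\<close>

lemma delta_adic_residue_iff:
  "u \<in> delta_adic_residue G \<longleftrightarrow> u \<in> Units ZG \<and> (\<forall>n. u - frag_of \<one> \<in> \<Delta> n)"
proof -
  have level: "u \<in> normalized_units_level G n \<longleftrightarrow> u \<in> normalized_units G \<and> u - frag_of \<one> \<in> \<Delta> n" for n
    by (auto simp: normalized_units_level_def a_l_coset_def' intro!: bexI[of _ "u - frag_of \<one>"])
  show ?thesis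
  proof
    assume u: "u \<in> delta_adic_residue G"
    then have *: "u \<in> normalized_units G \<and> u - frag_of \<one> \<in> \<Delta> n" if "n \<ge> 1" for n
      using level that by (auto simp: delta_adic_residue_def)
    have "u - frag_of \<one> \<in> \<Delta> n" for n
    proof (cases n)
      case 0
      then show ?thesis using *[of 1] \<Delta>_carrier[of _ 1] by auto
    next
      case (Suc k)
      then show ?thesis using *[of n] by simp
    qed
    then show "u \<in> Units ZG \<and> (\<forall>n. u - frag_of \<one> \<in> \<Delta> n)"
      using *[of 1] by (auto simp: normalized_units_def)
  next
    assume u: "u \<in> Units ZG \<and> (\<forall>n. u - frag_of \<one> \<in> \<Delta> n)"
    then have "u - frag_of \<one> \<in> \<Delta> (Suc 0)" by blast
    then have "augmentation u = 1"
      unfolding \<Delta>_one by (simp add: augmentation_ideal_iff augmentation_diff)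
    then have "u \<in> normalized_units G" using u by (simp add: normalized_units_def)
    then show "u \<in> delta_adic_residue G"
      using u level by (auto simp: delta_adic_residue_def)
  qed
qed

lemma Units_ZG_I:
  "\<lbrakk>u \<in> carrier ZG; v \<in> carrier ZG; u \<star> v = frag_of \<one>; v \<star> u = frag_of \<one>\<rbrakk> \<Longrightarrow> u \<in> Units ZG"
  by (auto simp: Units_def)

lemma one_mem_residue: "frag_of \<one> \<in> delta_adic_residue G"
  using Units_ZG_I[of "frag_of \<one>" "frag_of \<one>"] by (simp add: delta_adic_residue_iff)

section \<open>Elements of coprime order\<close>

text \<open>The binomial expansion of \<open>(1 + (a - 1))\<^sup>i\<close> up to second order. For \<open>a\<^sup>i = 1\<close> it shows that
  \<open>i (a - 1)\<close> lies one power of the augmentation ideal deeper than \<open>a - 1\<close>.\<close>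

lemma torsion_power_diff:
  assumes "a \<in> carrier G"
  shows "\<exists>d\<in>augmentation_ideal G. frag_of (a [^] i) - frag_of \<one> =
           frag_cmul (int i) (frag_of a - frag_of \<one>) + (frag_of a - frag_of \<one>) \<star> d"
proof (induction i)
  case 0
  show ?case by (rule bexI[of _ 0]) (auto simp: augmentation_ideal_iff)
next
  case (Suc i)
  then obtain d where d: "d \<in> augmentation_ideal G" "frag_of (a [^] i) - frag_of \<one> =
           frag_cmul (int i) (frag_of a - frag_of \<one>) + (frag_of a - frag_of \<one>) \<star> d" by blast
  show ?case
  proof (rule bexI)
    show "d + (frag_of (a [^] i) - frag_of \<one>) \<in> augmentation_ideal G"
      using d(1) assms by (simp add: augmentation_ideal_iff augmentation_add augmentation_diff)
    have "(frag_of a - frag_of \<one>) \<star> (frag_of (a [^] i) - frag_of \<one>) =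
       frag_of (a [^] Suc i) - frag_of (a [^] i) - (frag_of a - frag_of \<one>)"
      using assms pow_mult_distrib nat_pow_Suc2[of a i] by (simp add: mult_distribs)
    then show "frag_of (a [^] Suc i) - frag_of \<one> =
           frag_cmul (int (Suc i)) (frag_of a - frag_of \<one>) +
             (frag_of a - frag_of \<one>) \<star> (d + (frag_of (a [^] i) - frag_of \<one>))"
      using d(2) by (simp add: mult_add_right frag_cmul_distrib algebra_simps)
  qed
qed

lemma torsion_power_cmul_mem_\<Delta>:
  assumes a: "a \<in> carrier G" "a [^] m = \<one>"
  shows "frag_cmul (int (m ^ n)) (frag_of a - frag_of \<one>) \<in> \<Delta> (Suc n)"
proof (induction n)
  case 0
  then show ?case using a by (simp add: \<Delta>_one del: ideal_power.simps)
next
  case (Suc n)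
  obtain d where d: "d \<in> augmentation_ideal G"
     "0 = frag_cmul (int m) (frag_of a - frag_of \<one>) + (frag_of a - frag_of \<one>) \<star> d"
    using torsion_power_diff[OF a(1), of m] a by auto
  have "frag_cmul (int m) (frag_of a - frag_of \<one>) = - ((frag_of a - frag_of \<one>) \<star> d)"
    using d(2) by (simp add: eq_neg_iff_add_eq_0)
  then have "frag_cmul (int (m ^ n)) (frag_cmul (int m) (frag_of a - frag_of \<one>)) =
     - (frag_cmul (int (m ^ n)) (frag_of a - frag_of \<one>) \<star> d)"
    by (simp add: mult_cmul_left frag_cmul_diff_right[of _ 0, simplified])
  then show ?case
    using \<Delta>_minus[OF \<Delta>_Suc_mult[OF Suc d(1)]] by (simp add: mult.commute del: ideal_power.simps)
qed

text \<open>The product is driven into \<open>\<Delta> n\<close> both by a power of \<open>m\<close> (through its first factor) and by a power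
  of \<open>k\<close> (through its second factor), hence, by Bezout, by \<open>1\<close>. All elements of the
  residue constructed below come from such products.\<close>

lemma coprime_torsion_mult_mem_\<Delta>:
  assumes a: "a \<in> carrier G" "a [^] m = \<one>" and b: "b \<in> carrier G" "b [^] k = \<one>"
    and "coprime m (k :: nat)"
  shows "(frag_of a - frag_of \<one>) \<star> (frag_of b - frag_of \<one>) \<in> \<Delta> n"
proof -
  let ?w = "(frag_of a - frag_of \<one>) \<star> (frag_of b - frag_of \<one>)"
  have carr: "frag_of a - frag_of \<one> \<in> carrier ZG" "frag_of b - frag_of \<one> \<in> carrier ZG"
    using a b by auto
  have "frag_cmul (int (m ^ n)) ?w \<in> \<Delta> (Suc n)"
    using \<Delta>_mult_right[OF torsion_power_cmul_mem_\<Delta>[OF a, of n] carr(2)] by (simp add: mult_cmul_left)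
  moreover have "frag_cmul (int (k ^ n)) ?w \<in> \<Delta> (Suc n)"
    using \<Delta>_mult_left[OF torsion_power_cmul_mem_\<Delta>[OF b, of n] carr(1)] by (simp add: mult_cmul_right)
  moreover have "coprime (int (m ^ n)) (int (k ^ n))" using assms(5) by simp
  then obtain r s where "r * int (m ^ n) + s * int (k ^ n) = 1"
    by (metis bezout_int coprime_iff_gcd_eq_1)
  then have "?w = frag_cmul r (frag_cmul (int (m ^ n)) ?w) + frag_cmul s (frag_cmul (int (k ^ n)) ?w)"
    by (metis frag_cmul_cmul frag_cmul_distrib frag_cmul_one)
  ultimately have "?w \<in> \<Delta> (Suc n)" by (metis \<Delta>_add \<Delta>_cmul)
  then have "?w \<in> \<Delta> n \<inter> augmentation_ideal G"
    using ring.ideal_prod_inter[OF ring_group_ring ideal_\<Delta>[of n] ideal_augmentation_ideal] by auto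
  then show ?thesis by simp
qed

text \<open>Since \<open>ab - ba = (a - 1)(b - 1) - (b - 1)(a - 1)\<close>, the group commutator of \<open>a\<close> and \<open>b\<close> is itself an
  element of the residue.\<close>

lemma coprime_torsion_commute:
  assumes res: "delta_adic_residue G = {frag_of \<one>}"
    and a: "a \<in> carrier G" "a [^] m = \<one>" and b: "b \<in> carrier G" "b [^] k = \<one>"
    and cop: "coprime m (k::nat)"
  shows "a \<otimes> b = b \<otimes> a"
proof -
  let ?c = "a \<otimes> b \<otimes> inv (b \<otimes> a)"
  have c: "?c \<in> carrier G" using a b by simp
  have "frag_of (a \<otimes> b) - frag_of (b \<otimes> a) =
     (frag_of a - frag_of \<one>) \<star> (frag_of b - frag_of \<one>) - (frag_of b - frag_of \<one>) \<star> (frag_of a - frag_of \<one>)"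
    using a b by (simp add: mult_distribs)
  then have "frag_of (a \<otimes> b) - frag_of (b \<otimes> a) \<in> \<Delta> n" for n
    using coprime_torsion_mult_mem_\<Delta>[OF a b] coprime_torsion_mult_mem_\<Delta>[OF b a] cop
    by (simp add: \<Delta>_diff coprime_commute)
  moreover have "frag_of ?c - frag_of \<one> = (frag_of (a \<otimes> b) - frag_of (b \<otimes> a)) \<star> frag_of (inv (b \<otimes> a))"
    using a b by (simp add: mult_distribs del: inv_mult_group)
  ultimately have "frag_of ?c - frag_of \<one> \<in> \<Delta> n" for n
    using a b \<Delta>_mult_right[of _ n "frag_of (inv (b \<otimes> a))"] by (simp del: inv_mult_group)
  moreover have "frag_of ?c \<in> Units ZG"
    by (rule Units_ZG_I[of _ "frag_of (inv ?c)"]) (use c in \<open>simp_all del: inv_mult_group\<close>)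
  ultimately have "frag_of ?c \<in> delta_adic_residue G" by (simp only: delta_adic_residue_iff) blast
  then have "?c = \<one>" using res by (simp only: singleton_iff frag_of_eq)
  then show ?thesis using a b by (metis inv_equality inv_inv m_closed inv_closed)
qed

lemma torsion_pow_mod:
  assumes "x \<in> carrier G" "x [^] m = \<one>"
  shows "x [^] (n mod m) = x [^] (n :: nat)"
proof -
  have "x [^] n = x [^] (m * (n div m) + n mod m)" by simp
  also have "\<dots> = (x [^] m) [^] (n div m) \<otimes> x [^] (n mod m)"
    using assms(1) by (simp only: nat_pow_mult nat_pow_pow)
  finally show ?thesis using assms by simp
qed

end

section \<open>Elements of the same prime order: bicyclic units\<close>

context group
begin

text \<open>If \<open>y\<close> normalises the group generated by \<open>x\<close>, raising \<open>x\<close> to the \<open>k\<close>-th power is conjugation by \<open>y\<close>.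
  Its \<open>r\<close>-fold iterate \<open>x \<mapsto> x [^] k ^ r\<close> is trivial because \<open>y\<^sup>r = 1\<close>, and it equals
  \<open>x \<mapsto> x [^] k\<close> by Fermat's little theorem.\<close>

lemma conj_power_commute:
  fixes r :: nat
  assumes x: "x \<in> carrier G" "x [^] r = \<one>" and y: "y \<in> carrier G" "y [^] r = \<one>"
    and r: "Factorial_Ring.prime r" and conj: "x \<otimes> y = y \<otimes> x [^] (k::nat)"
  shows "x \<otimes> y = y \<otimes> x"
proof -
  have pow: "x [^] n \<otimes> y = y \<otimes> x [^] (k * n)" for n :: nat
  proof (induction n)
    case (Suc n)
    have "x [^] Suc n \<otimes> y = x [^] n \<otimes> (x \<otimes> y)" using x y by (simp add: m_assoc)
    also have "\<dots> = (x [^] n \<otimes> y) \<otimes> x [^] k" using x y conj by (simp add: m_assoc)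
    finally show ?case using x y Suc by (simp add: m_assoc nat_pow_mult add.commute)
  qed (use x y in simp)
  have "x \<otimes> y [^] j = y [^] j \<otimes> x [^] (k ^ j)" for j :: nat
  proof (induction j)
    case (Suc j)
    have "x \<otimes> y [^] Suc j = y [^] j \<otimes> (x [^] (k ^ j) \<otimes> y)"
      using x y Suc by (simp flip: m_assoc)
    then show ?case using x y pow[of "k ^ j"] by (simp add: m_assoc)
  qed (use x y in simp)
  from this[of r] have 1: "x = x [^] (k ^ r)" using x y by simp
  have "[k ^ r = k] (mod r)"
  proof (cases "r dvd k")
    case True
    then show ?thesis using r by (metis cong_0_iff cong_pow cong_sym cong_trans power_0_left prime_gt_0_nat zero_power)
  next
    case False
    then have "[k ^ (r - 1) * k = 1 * k] (mod r)"
      using fermat_theorem[OF r] by (intro cong_mult) auto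
    then show ?thesis using power_minus_mult[OF prime_gt_0_nat[OF r], of k] by simp
  qed
  then have "x [^] (k ^ r) = x [^] k"
    using torsion_pow_mod[OF x] by (metis cong_def)
  then show ?thesis using 1 conj by simp
qed

text \<open>Put \<open>s = 1 + x + \<dots> + x\<^sup>r\<^sup>-\<^sup>1\<close>. The element \<open>e = (x - 1) y s\<close> has square \<open>0\<close> because
  \<open>s (x - 1) = 0\<close>, and it vanishes only if \<open>y\<close> normalises the group generated by \<open>x\<close>. An element \<open>z\<close> of coprime
  order commutes with \<open>x\<close> and \<open>y\<close>, so \<open>w = (z - 1) e\<close> also has square \<open>0\<close>, and \<open>1 + w\<close> is a unit with
  inverse \<open>1 - w\<close>. It belongs to the residue because \<open>w\<close> has the factor \<open>(z - 1)(x - 1)\<close>. As the residue is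
  trivial, \<open>w = 0\<close>, that is, \<open>ze = e\<close>, and comparing coefficients at \<open>y\<close> forces \<open>x\<close> and \<open>y\<close> to commute.\<close>

lemma same_prime_torsion_commute:
  assumes res: "delta_adic_residue G = {frag_of \<one>}"
    and x: "x \<in> carrier G" "x [^] r = \<one>" and y: "y \<in> carrier G" "y [^] r = \<one>"
    and z: "z \<in> carrier G" "z [^] q = \<one>" "z \<noteq> \<one>"
    and r: "Factorial_Ring.prime (r :: nat)" and cop: "coprime r (q :: nat)"
  shows "x \<otimes> y = y \<otimes> x"
proof -
  have zx: "z \<otimes> x = x \<otimes> z" and zy: "z \<otimes> y = y \<otimes> z"
    using coprime_torsion_commute[OF res x z(1,2) cop] coprime_torsion_commute[OF res y z(1,2) cop] by auto
  have r0: "r > 0" using r by (simp add: prime_gt_0_nat)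
  define s where "s = (\<Sum>i<r. frag_of (x [^] i))"
  define e where "e = (frag_of x - frag_of \<one>) \<star> (frag_of y \<star> s)"
  define w where "w = (frag_of z - frag_of \<one>) \<star> e"
  have zxi: "z \<otimes> x [^] i = x [^] i \<otimes> z" for i :: nat
    using pow_mult_distrib[OF zx z(1) x(1)] zx x z 
    by (induction i) (simp_all add: m_assoc, metis m_assoc nat_pow_closed)
  have s: "s \<in> carrier ZG" unfolding s_def using x by (intro ZG_sum_closed) simp
  have e: "e \<in> carrier ZG" unfolding e_def using x y s by simp
  have w: "w \<in> carrier ZG" unfolding w_def using z e by simp
  have tele: "(\<Sum>i<r. frag_of (x [^] Suc i)) - (\<Sum>i<r. frag_of (x [^] i)) = 0"
    using x sum_lessThan_telescope[of "\<lambda>i. frag_of (x [^] i)" r] by (simp add: sum_subtractf)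
  have sx: "s \<star> (frag_of x - frag_of \<one>) = 0"
    using tele x s by (simp add: mult_diff_right) (simp add: s_def mult_sum_left)
  have "s \<star> e = 0"
    using sx x y s unfolding e_def by (simp add: mult_assoc[symmetric])
  then have ee: "e \<star> e = 0"
    using x y s e by (subst e_def) (simp add: mult_assoc)
  have e_sum: "e = (\<Sum>i<r. frag_of (x \<otimes> y \<otimes> x [^] i)) - (\<Sum>i<r. frag_of (y \<otimes> x [^] i))"
    using x y by (simp add: e_def s_def mult_sum_right mult_diff_left ZG_sum_closed m_assoc sum_subtractf)
  have ze_sum: "frag_of z \<star> e = (\<Sum>i<r. frag_of (z \<otimes> (x \<otimes> y \<otimes> x [^] i))) - (\<Sum>i<r. frag_of (z \<otimes> (y \<otimes> x [^] i)))"
    by (simp add: e_sum mult_sum_right mult_diff_right)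
  have ez_sum: "e \<star> frag_of z = (\<Sum>i<r. frag_of (x \<otimes> y \<otimes> x [^] i \<otimes> z)) - (\<Sum>i<r. frag_of (y \<otimes> x [^] i \<otimes> z))"
    by (simp add: e_sum mult_sum_left mult_diff_left)
  have c1: "z \<otimes> (y \<otimes> x [^] i) = y \<otimes> x [^] i \<otimes> z" for i :: nat
    using x y z zy zxi by (metis m_assoc nat_pow_closed)
  have c2: "z \<otimes> (x \<otimes> y \<otimes> x [^] i) = x \<otimes> y \<otimes> x [^] i \<otimes> z" for i :: nat
    using x y z zx c1[of i] by (metis m_assoc nat_pow_closed m_closed)
  have ez: "e \<star> (frag_of z - frag_of \<one>) = w"
    using e z by (simp add: w_def mult_distribs ze_sum ez_sum c1 c2)
  have "w \<star> w = e \<star> (frag_of z - frag_of \<one>) \<star> ((frag_of z - frag_of \<one>) \<star> e)"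
    by (simp add: ez) (simp add: w_def)
  also have "\<dots> = (frag_of z - frag_of \<one>) \<star> (e \<star> e) \<star> (frag_of z - frag_of \<one>)"
    using e z ez by (simp add: mult_assoc w_def)
  finally have ww: "w \<star> w = 0" by (simp add: ee)
  have "frag_of \<one> + w \<in> Units ZG"
    by (rule Units_ZG_I[of _ "frag_of \<one> - w"]) (use w ww in \<open>simp_all add: mult_distribs\<close>)
  moreover have "w \<in> \<Delta> n" for n
  proof -
    have "w = (frag_of z - frag_of \<one>) \<star> (frag_of x - frag_of \<one>) \<star> (frag_of y \<star> s)"
      using x y z s by (simp add: w_def e_def mult_assoc)
    then show ?thesis
      using coprime_torsion_mult_mem_\<Delta>[OF z(1,2) x, of n] cop y s
      by (simp add: \<Delta>_mult_right coprime_commute)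
  qed
  ultimately have "frag_of \<one> + w \<in> delta_adic_residue G" by (simp add: delta_adic_residue_iff)
  then have "w = 0" using res by simp
  then have ze: "frag_of z \<star> e = e" using e by (simp add: w_def mult_diff_left)
  show ?thesis
  proof (rule ccontr)
    assume neq: "x \<otimes> y \<noteq> y \<otimes> x"
    have ne: "x \<otimes> y \<otimes> x [^] i \<noteq> y" if "i < r" for i
    proof
      assume *: "x \<otimes> y \<otimes> x [^] i = y"
      have "x \<otimes> y = x \<otimes> y \<otimes> (x [^] i \<otimes> x [^] (r - i))"
        using that x y by (simp add: nat_pow_mult)
      also have "\<dots> = y \<otimes> x [^] (r - i)" using * x y by (simp add: m_assoc[symmetric])
      finally show False using conj_power_commute[OF x y r] neq by blast
    qed
    \<comment> \<open>No element \<open>x y x\<^sup>i\<close> equals \<open>y\<close>, so only the terms \<open>- y x\<^sup>i\<close> of \<open>e\<close> contribute at \<open>y\<close>.\<close>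
    have "Poly_Mapping.lookup e y = - (\<Sum>i<r. if y \<otimes> x [^] i = y then 1 else 0)"
    proof -
      have "(\<Sum>i<r. Poly_Mapping.lookup (frag_of (x \<otimes> y \<otimes> x [^] i)) y) = 0"
        using ne[THEN not_sym] by (intro sum.neutral) auto
      then show ?thesis by (simp add: e_sum lookup_minus lookup_sum eq_commute[of y])
    qed
    also have "\<dots> \<le> - (\<Sum>i\<in>{0}. if y \<otimes> x [^] (i::nat) = y then 1 else 0)"
      using r0 by (intro le_imp_neg_le sum_mono2) auto
    also have "\<dots> < 0" using y by simp
    finally have "Poly_Mapping.lookup (frag_of z \<star> e) y < 0" by (simp add: ze)
    moreover have "Poly_Mapping.lookup (frag_of z \<star> e) y \<ge> - (\<Sum>i<r. if z \<otimes> (y \<otimes> x [^] i) = y then 1 else 0)"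
      by (simp add: ze_sum lookup_minus lookup_sum sum_nonneg eq_commute[of y])
    ultimately have "(\<Sum>i<r. if z \<otimes> (y \<otimes> x [^] i) = y then 1 else 0) \<noteq> (0::int)" by linarith
    \<comment> \<open>Then \<open>z\<close> is a power of \<open>x\<close>, and its order divides the coprime numbers \<open>r\<close> and \<open>q\<close>.\<close>
    then obtain i :: nat where "z \<otimes> (y \<otimes> x [^] i) = y"
      by (rule sum.not_neutral_contains_not_neutral) (auto split: if_splits)
    then have "y \<otimes> (x [^] i \<otimes> z) = y \<otimes> \<one>" using c1 x y z by (simp add: m_assoc)
    then have "x [^] i \<otimes> z = \<one>" using x y z by (metis l_cancel m_closed nat_pow_closed one_closed)
    then have zi: "z = inv (x [^] i)" using x z by (metis inv_equality inv_inv nat_pow_closed inv_closed)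
    have "z [^] r = inv ((x [^] i) [^] r)" unfolding zi using x by (simp add: nat_pow_inv)
    also have "(x [^] i) [^] r = (x [^] r) [^] i" using x(1) by (simp add: nat_pow_pow mult.commute)
    also have "\<dots> = \<one>" using x(2) by simp
    finally have "z [^] r = \<one>" by simp
    then have "ord z dvd r" "ord z dvd q" using z pow_eq_id by auto
    then have "ord z = 1" using cop by (metis coprime_common_divisor_nat)
    then show False using z ord_eq_1 by simp
  qed
qed

end

section \<open>Linear extension of complex functions to the group ring\<close>

definition linear_extension :: "('a \<Rightarrow> complex) \<Rightarrow> ('a \<Rightarrow>\<^sub>0 int) \<Rightarrow> complex" where
  "linear_extension \<chi> a = (\<Sum>x\<in>Poly_Mapping.keys a. of_int (Poly_Mapping.lookup a x) * \<chi> x)"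

lemma linear_extension_superset:
  assumes "finite S" "Poly_Mapping.keys a \<subseteq> S"
  shows "linear_extension \<chi> a = (\<Sum>x\<in>S. of_int (Poly_Mapping.lookup a x) * \<chi> x)"
  unfolding linear_extension_def using assms
  by (intro sum.mono_neutral_left) (auto simp: in_keys_iff)

lemma linear_extension_frag_of [simp]: "linear_extension \<chi> (frag_of x) = \<chi> x"
  by (simp add: linear_extension_def)

lemma linear_extension_zero [simp]: "linear_extension \<chi> 0 = 0"
  by (simp add: linear_extension_def)

lemma linear_extension_diff:
  "linear_extension \<chi> (a - b) = linear_extension \<chi> a - linear_extension \<chi> b"
  by (subst (1 2 3) linear_extension_superset[of "Poly_Mapping.keys a \<union> Poly_Mapping.keys b"])
     (auto simp: keys_diff lookup_minus sum_subtractf algebra_simps)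

lemma linear_extension_add:
  "linear_extension \<chi> (a + b) = linear_extension \<chi> a + linear_extension \<chi> b"
  using linear_extension_diff[of \<chi> "a + b" b] by simp

lemma linear_extension_cmul:
  "linear_extension \<chi> (frag_cmul c a) = of_int c * linear_extension \<chi> a"
  by (subst (1 2) linear_extension_superset[of "Poly_Mapping.keys a"])
     (auto simp: sum_distrib_left mult.assoc)

lemma linear_extension_sum:
  "linear_extension \<chi> (sum f I) = (\<Sum>i\<in>I. linear_extension \<chi> (f i))"
  by (induction I rule: infinite_finite_induct) (auto simp: linear_extension_add)

section \<open>Elements of coprime order: units in cyclic group rings\<close>

text \<open>A device for producing units, formulated modulo an ideal \<open>I\<close> of a commutative ring whose
  quotient has no \<open>n\<close>-torsion. Here \<open>\<epsilon>\<close> is a unit modulo the annihilator of \<open>\<theta>\<close>, with inverse \<open>\<delta>\<close>, and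
  \<open>\<epsilon>\<^sup>d\<close> acts as \<open>1\<close> modulo \<open>n\<close>. As \<open>n \<theta>\<close> is a multiple of \<open>\<theta>\<^sup>2\<close>, this gives \<open>\<epsilon>\<^sup>d \<theta> = (1 + \<theta> t) \<theta>\<close>, and
  likewise \<open>\<delta>\<^sup>d \<theta> = (1 + \<theta> t') \<theta>\<close>. The product of the two factors fixes \<open>\<theta>\<close>, so it is
  \<open>1 + \<theta> s\<close> with \<open>\<theta>\<^sup>2 s = 0\<close>. This implies \<open>n \<theta> s = 0\<close>, hence \<open>\<theta> s = 0\<close>.\<close>

lemma lift_unit_modulo_annihilator:
  fixes I :: "'r :: comm_ring_1 set"
  assumes I_add: "\<And>p q. p \<in> I \<Longrightarrow> q \<in> I \<Longrightarrow> p + q \<in> I"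
    and I_mult: "\<And>p q. p \<in> I \<Longrightarrow> q * p \<in> I"
    and torsion: "\<And>p. of_nat n * p \<in> I \<Longrightarrow> p \<in> I"
    and \<epsilon>: "\<epsilon> * \<delta> * \<theta> - \<theta> \<in> I"
    and c: "of_nat n * \<theta> - \<theta>\<^sup>2 * c \<in> I"
    and W: "\<epsilon> ^ (j + d) - \<epsilon> ^ j - of_nat n * W \<in> I"
  obtains t t' where "(1 + \<theta> * t) * (1 + \<theta> * t') - 1 \<in> I"
    and "(1 + \<theta> * t) * \<theta> - \<epsilon> ^ d * \<theta> \<in> I"
proof -
  have I_minus: "- p \<in> I" if "p \<in> I" for p
    using I_mult[OF that, of "-1"] by simp
  have I_diff: "p - q \<in> I" if "p \<in> I" "q \<in> I" for p q
    using I_add[OF that(1) I_minus[OF that(2)]] by simp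
  \<comment> \<open>The membership proofs below exhibit each element as an explicit combination of members of \<open>I\<close>.\<close>
  have e: "\<epsilon> ^ i * \<delta> ^ i * \<theta> - \<theta> \<in> I" for i
  proof (induction i)
    case 0
    show ?case using I_mult[OF c, of 0] by simp
  next
    case (Suc i)
    have "\<epsilon> ^ Suc i * \<delta> ^ Suc i * \<theta> - \<theta> =
       (\<epsilon> ^ i * \<delta> ^ i) * (\<epsilon> * \<delta> * \<theta> - \<theta>) + (\<epsilon> ^ i * \<delta> ^ i * \<theta> - \<theta>)"
      by (simp add: algebra_simps)
    then show ?case using I_add[OF I_mult[OF \<epsilon>] Suc] by metis
  qed
  define t where "t = W * \<delta> ^ j * c"
  define p where "p = \<epsilon> ^ d * \<theta> - \<theta> - \<theta>\<^sup>2 * t"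
  have "p = \<delta> ^ j * \<theta> * (\<epsilon> ^ (j + d) - \<epsilon> ^ j - of_nat n * W)
       + (1 - \<epsilon> ^ d) * (\<epsilon> ^ j * \<delta> ^ j * \<theta> - \<theta>) + W * \<delta> ^ j * (of_nat n * \<theta> - \<theta>\<^sup>2 * c)"
    by (simp add: p_def t_def algebra_simps power_add)
  then have p: "p \<in> I"
    using I_add[OF I_add[OF I_mult[OF W] I_mult[OF e]] I_mult[OF c]] by metis
  define t' where "t' = - (\<delta> ^ d * t)"
  define s where "s = t + t' + \<theta> * t * t'"
  have "\<theta>\<^sup>2 * s = p * (- \<theta> * t') - \<theta> * t * (\<epsilon> ^ d * \<delta> ^ d * \<theta> - \<theta>)"
    by (simp add: s_def t'_def p_def algebra_simps power2_eq_square)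
  also have "\<dots> \<in> I" using I_diff[OF I_mult[OF p] I_mult[OF e]] by (metis mult.commute)
  finally have "\<theta>\<^sup>2 * s \<in> I" .
  moreover have "of_nat n * (\<theta> * s) = s * (of_nat n * \<theta> - \<theta>\<^sup>2 * c) + c * (\<theta>\<^sup>2 * s)"
    by (simp add: algebra_simps)
  ultimately have "of_nat n * (\<theta> * s) \<in> I" using I_add[OF I_mult[OF c] I_mult] by metis
  then have "\<theta> * s \<in> I" by (rule torsion)
  moreover have "(1 + \<theta> * t) * (1 + \<theta> * t') - 1 = \<theta> * s"
    by (simp add: s_def algebra_simps)
  moreover have "(1 + \<theta> * t) * \<theta> - \<epsilon> ^ d * \<theta> = - p"
    by (simp add: p_def algebra_simps power2_eq_square)
  ultimately show ?thesis using that[of t t'] I_minus[OF p] by metis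
qed

text \<open>The sum \<open>1 + y + \<dots> + y\<^sup>m\<^sup>-\<^sup>1\<close> differs from \<open>m\<close> by a multiple of \<open>1 - y\<close>; multiplying by \<open>1 - y\<close>
  gives the claim. For \<open>y\<^sup>m = 1\<close> it says that \<open>m (1 - y)\<close> is a multiple of \<open>(1 - y)\<^sup>2\<close>.\<close>

lemma of_nat_mult_one_minus:
  fixes y :: "'r :: comm_ring_1"
  shows "of_nat m * (1 - y) = (1 - y)\<^sup>2 * (\<Sum>i<m. \<Sum>j<i. y ^ j) + (1 - y ^ m)"
proof (induction m)
  case (Suc m)
  have "(1 - y) * (\<Sum>j<m. y ^ j) = 1 - y ^ m" by (simp add: one_diff_power_eq)
  then have key: "(1 - y)\<^sup>2 * (\<Sum>j<m. y ^ j) = (1 - y) * (1 - y ^ m)"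
    by (simp add: power2_eq_square mult.assoc)
  have "of_nat (Suc m) * (1 - y) = of_nat m * (1 - y) + (1 - y)" by (simp add: algebra_simps)
  also have "\<dots> = (1 - y)\<^sup>2 * (\<Sum>i<m. \<Sum>j<i. y ^ j) + (1 - y ^ m) + (1 - y)" by (simp only: Suc)
  also have "\<dots> = (1 - y)\<^sup>2 * (\<Sum>i<m. \<Sum>j<i. y ^ j) + (1 - y) * (1 - y ^ m) + (1 - y ^ Suc m)"
    by (simp add: algebra_simps)
  finally show ?case by (simp add: key distrib_left)
qed simp

text \<open>The absolute value is \<open>2 sin (\<pi> / n)\<close>. At \<open>n = 6\<close> it is exactly one, which is why order six is the
  exception among the cyclic groups that are not \<open>p\<close>-groups.\<close>

lemma norm_one_minus_root_of_unity_less_one: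
  assumes "n > 6"
  shows "cmod (1 - cis (2 * pi / real n)) < 1"
proof -
  let ?t = "2 * pi / real n"
  have "?t < pi / 3" using assms by (simp add: field_simps)
  then have "cos (pi / 3) < cos ?t"
    by (intro cos_monotone_0_pi) auto
  then have *: "cos ?t > 1 / 2" by (simp add: cos_60)
  have "(cmod (1 - cis ?t))\<^sup>2 = (1 - cos ?t)\<^sup>2 + (sin ?t)\<^sup>2" by (simp add: cmod_power2)
  also have "\<dots> = 2 - 2 * cos ?t" 
    using sin_cos_squared_add[of ?t] by (simp add: power2_eq_square algebra_simps)
  also have "\<dots> < 1" using * by simp
  finally show ?thesis by (simp add: power2_less_1_iff abs_less_iff)
qed

lemma root_of_unity_power_neq_one:
  assumes "0 < k" "k < n"
  shows "cis (2 * pi / real n) ^ k \<noteq> 1"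
proof
  assume "cis (2 * pi / real n) ^ k = 1"
  then have "cis (2 * pi * real k / real n) = cis (2 * pi * real 0 / real n)"
    by (simp add: DeMoivre mult_ac)
  moreover have "inj_on (\<lambda>k. cis (2 * pi * real k / real n)) {..<n}"
    using bij_betw_roots_unity[of n] assms by (simp add: bij_betw_def)
  ultimately show False
    using assms inj_onD[of "\<lambda>k. cis (2 * pi * real k / real n)" "{..<n}" k 0] by auto
qed

lemma complex_value_add:
  "poly (map_poly of_int (P + Q)) \<zeta> = poly (map_poly of_int P) \<zeta> + poly (map_poly of_int Q) (\<zeta> :: complex)"
proof -
  have "map_poly of_int (P + Q) = map_poly of_int P + (map_poly of_int Q :: complex poly)"
    by (intro poly_eqI) (simp add: coeff_map_poly)
  then show ?thesis by simp
qed

lemma complex_value_diff: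
  "poly (map_poly of_int (P - Q)) \<zeta> = poly (map_poly of_int P) \<zeta> - poly (map_poly of_int Q) (\<zeta> :: complex)"
  using complex_value_add[of "P - Q" Q \<zeta>] by simp

lemma complex_value_mult:
  "poly (map_poly of_int (P * Q)) \<zeta> = poly (map_poly of_int P) \<zeta> * poly (map_poly of_int Q) (\<zeta> :: complex)"
  by (induction P rule: pCons_induct)
     (simp_all add: mult_pCons_left complex_value_add map_poly_smult map_poly_pCons algebra_simps)

lemma complex_value_power:
  "poly (map_poly of_int (P ^ n)) \<zeta> = poly (map_poly of_int P) (\<zeta> :: complex) ^ n"
  by (induction n) (simp_all add: complex_value_mult)

lemmas complex_value_simps = complex_value_diff complex_value_mult complex_value_power
  map_poly_monom poly_monom

text \<open>The subring generated by a single group element is commutative; writing its elements as values of integer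
  polynomials makes the computations there calculations in a commutative ring type.\<close>

definition poly_at :: "('a, 'b) monoid_scheme \<Rightarrow> 'a \<Rightarrow> int poly \<Rightarrow> 'a \<Rightarrow>\<^sub>0 int" where
  "poly_at G x P = (\<Sum>i\<le>Polynomial.degree P. frag_cmul (Polynomial.coeff P i) (frag_of (x [^]\<^bsub>G\<^esub> i)))"

context group
begin

lemma poly_at_superset:
  assumes "Polynomial.degree P \<le> n"
  shows "poly_at G x P = (\<Sum>i\<le>n. frag_cmul (Polynomial.coeff P i) (frag_of (x [^] i)))"
  unfolding poly_at_def using assms
  by (intro sum.mono_neutral_left) (auto simp: coeff_eq_0)

lemma poly_at_add: "poly_at G x (P + Q) = poly_at G x P + poly_at G x Q"
  by (subst (1 2 3) poly_at_superset[of _ "max (Polynomial.degree P) (Polynomial.degree Q)"])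
     (auto simp: degree_add_le frag_cmul_distrib sum.distrib)

lemma poly_at_smult: "poly_at G x (smult c P) = frag_cmul c (poly_at G x P)"
  by (subst (1 2) poly_at_superset[of _ "Polynomial.degree P"])
     (auto simp: frag_cmul_sum degree_smult_le)

lemma poly_at_zero [simp]: "poly_at G x 0 = 0"
  by (simp add: poly_at_def)

lemma poly_at_diff: "poly_at G x (P - Q) = poly_at G x P - poly_at G x Q"
  using poly_at_add[of x "P - Q" Q] by simp

lemma poly_at_sum: "poly_at G x (sum f I) = (\<Sum>i\<in>I. poly_at G x (f i))"
  by (induction I rule: infinite_finite_induct) (auto simp: poly_at_add)

lemma poly_at_closed [simp]: "x \<in> carrier G \<Longrightarrow> poly_at G x P \<in> carrier ZG"
  unfolding poly_at_def by (intro ZG_sum_closed) simp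

lemma poly_at_pCons:
  assumes "x \<in> carrier G"
  shows "poly_at G x (pCons c P) = frag_cmul c (frag_of \<one>) + frag_of x \<star> poly_at G x P"
  using assms
  by (subst poly_at_superset[of _ "Suc (Polynomial.degree P)"])
     (auto simp: degree_pCons_le sum.atMost_Suc_shift poly_at_def mult_sum_right mult_cmul_right
        nat_pow_Suc2[OF assms, unfolded nat_pow_Suc] simp del: sum.atMost_Suc)

lemma poly_at_mult:
  assumes "x \<in> carrier G"
  shows "poly_at G x (P * Q) = poly_at G x P \<star> poly_at G x Q"
proof (induction P rule: pCons_induct)
  case (pCons c P)
  have "poly_at G x (pCons c P * Q) = poly_at G x (smult c Q) + poly_at G x (pCons 0 (P * Q))"
    by (simp add: mult_pCons_left poly_at_add)
  then show ?case using assms pCons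
    by (simp add: poly_at_smult poly_at_pCons mult_distribs mult_assoc)
qed simp

lemma poly_at_one [simp]: "poly_at G x 1 = frag_of \<one>"
  by (simp add: poly_at_def)

lemma poly_at_monom [simp]: "poly_at G x (Polynomial.monom c n) = frag_cmul c (frag_of (x [^] n))"
  by (subst poly_at_superset[of _ n]) (auto simp: degree_monom_le if_distrib[of "\<lambda>c. frag_cmul c _"] cong: if_cong)

lemma linear_extension_poly_at:
  assumes "\<And>i. \<psi> (x [^] i) = \<zeta> ^ (i :: nat)"
  shows "linear_extension \<psi> (poly_at G x P) = poly (map_poly of_int P) \<zeta>"
proof -
  have "poly (map_poly of_int P) \<zeta> = (\<Sum>i\<le>Polynomial.degree P. of_int (Polynomial.coeff P i) * \<zeta> ^ i)"
    by (subst poly_altdef) (simp add: coeff_map_poly degree_map_poly)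
  then show ?thesis
    by (simp add: poly_at_def linear_extension_sum linear_extension_cmul assms)
qed

text \<open>Substituting an \<open>ord x\<close>-th root of unity \<open>\<zeta>\<close> for \<open>x\<close> is well defined: it is the linear extension of
  \<open>x\<^sup>i \<mapsto> \<zeta>\<^sup>i\<close>.\<close>

lemma poly_at_determines_value:
  assumes x: "x \<in> carrier G" and \<zeta>: "\<zeta> ^ ord x = 1" and eq: "poly_at G x P = poly_at G x Q"
  shows "poly (map_poly of_int P) \<zeta> = poly (map_poly of_int Q) (\<zeta> :: complex)"
proof -
  have wd: "\<zeta> ^ i = \<zeta> ^ j" if "x [^] i = x [^] j" for i j :: nat
  proof -
    have "int (ord x) dvd int j - int i" using that x int_pow_eq[of x "int i" "int j"] by (simp add: int_pow_int)
    then have "[int j = int i] (mod int (ord x))" by (simp add: cong_iff_dvd_diff)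
    then have "i mod ord x = j mod ord x" by (simp only: cong_int_iff) (simp add: cong_def)
    moreover have "\<zeta> ^ k = \<zeta> ^ (k mod ord x)" for k
    proof -
      have "\<zeta> ^ k = \<zeta> ^ (ord x * (k div ord x) + k mod ord x)" by simp
      also have "\<dots> = \<zeta> ^ (k mod ord x)" using \<zeta> by (simp only: power_add power_mult power_one mult_1)
      finally show ?thesis .
    qed
    ultimately show ?thesis by metis
  qed
  define \<psi> where "\<psi> y = \<zeta> ^ (SOME i. x [^] i = y)" for y
  have "\<psi> (x [^] i) = \<zeta> ^ i" for i :: nat
    unfolding \<psi>_def by (rule wd) (rule someI[of _ i], rule refl)
  then show ?thesis using linear_extension_poly_at[of \<psi> x \<zeta>] eq by metis
qed

lemma keys_poly_at:
  assumes x: "x \<in> carrier G" and n: "0 < ord x"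
  shows "Poly_Mapping.keys (poly_at G x P) \<subseteq> (\<lambda>i. x [^] i) ` {..<ord x}"
proof -
  have "x [^] i \<in> (\<lambda>i. x [^] i) ` {..<ord x}" for i :: nat
    using torsion_pow_mod[OF x pow_ord_eq_1[OF x], of i] n by (metis imageI lessThan_iff mod_less_divisor)
  then show ?thesis
    unfolding poly_at_def
    by (intro subset_trans[OF keys_sum]) (auto dest!: keys_cmul[THEN subsetD])
qed

lemma poly_at_divisible:
  assumes x: "x \<in> carrier G" and n: "0 < ord x"
    and dvd: "\<And>y. int (ord x) dvd Poly_Mapping.lookup (poly_at G x P) y"
  obtains W where "poly_at G x P = poly_at G x (of_nat (ord x) * W)"
proof
  let ?S = "(\<lambda>i. x [^] i) ` {..<ord x}"
  let ?f = "Poly_Mapping.lookup (poly_at G x P)"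
  define W where "W = (\<Sum>i\<in>{..<ord x}. Polynomial.monom (?f (x [^] i) div int (ord x)) i)"
  have inj: "inj_on (\<lambda>i. x [^] i) {..<ord x}"
    using ord_inj[OF x] by (rule inj_on_subset) auto
  have "Poly_Mapping.keys (poly_at G x P) \<subseteq> ?S"
    using x n by (rule keys_poly_at)
  then have "poly_at G x P = (\<Sum>y\<in>?S. frag_cmul (?f y) (frag_of y))"
    by (subst frag_expansion, unfold frag_extend_def, intro sum.mono_neutral_left) (auto simp: in_keys_iff)
  also have "\<dots> = (\<Sum>i\<in>{..<ord x}. frag_cmul (?f (x [^] i)) (frag_of (x [^] i)))"
    using inj by (simp add: sum.reindex)
  also have "\<dots> = (\<Sum>i\<in>{..<ord x}. frag_cmul (int (ord x)) (poly_at G x (Polynomial.monom (?f (x [^] i) div int (ord x)) i)))"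
    using dvd by simp
  also have "\<dots> = frag_cmul (int (ord x)) (poly_at G x W)"
    unfolding W_def frag_cmul_sum[symmetric] by (simp add: poly_at_sum)
  also have "\<dots> = poly_at G x (of_nat (ord x) * W)"
    by (simp add: poly_at_smult[symmetric] of_nat_poly)
  finally show "poly_at G x P = poly_at G x (of_nat (ord x) * W)" .
qed

text \<open>Modulo \<open>ord x\<close> the powers of \<open>E(x)\<close> take only finitely many values, because they are supported on the
  powers of \<open>x\<close>.\<close>

lemma poly_at_power_pigeonhole:
  assumes x: "x \<in> carrier G" and n: "0 < ord x"
  obtains j d W where "d > 0" "poly_at G x (E ^ (j + d) - E ^ j - of_nat (ord x) * W) = 0"
proof -
  let ?S = "(\<lambda>i. x [^] i) ` {..<ord x}"
  define F where "F j = restrict (\<lambda>y. Poly_Mapping.lookup (poly_at G x (E ^ j)) y mod int (ord x)) ?S" for j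
  have "F ` UNIV \<subseteq> Pi\<^sub>E ?S (\<lambda>_. {0..<int (ord x)})"
    using n by (auto simp: F_def)
  moreover have "finite (Pi\<^sub>E ?S (\<lambda>_. {0..<int (ord x)}))" by (intro finite_PiE) auto
  ultimately have "\<not> inj F" using finite_subset finite_imageD infinite_UNIV_nat by metis
  then obtain i j where ij: "F i = F j" "i < j" by (metis injI linorder_neqE_nat)
  have keys: "Poly_Mapping.keys (poly_at G x P) \<subseteq> ?S" for P
    using x n by (rule keys_poly_at)
  have "int (ord x) dvd Poly_Mapping.lookup (poly_at G x (E ^ j - E ^ i)) y" for y
  proof (cases "y \<in> ?S")
    case True
    then have "Poly_Mapping.lookup (poly_at G x (E ^ j)) y mod int (ord x) = Poly_Mapping.lookup (poly_at G x (E ^ i)) y mod int (ord x)"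
      using fun_cong[OF ij(1), of y] by (simp add: F_def)
    then show ?thesis by (simp add: poly_at_diff lookup_minus mod_eq_dvd_iff)
  next
    case False
    then have "y \<notin> Poly_Mapping.keys (poly_at G x (E ^ j - E ^ i))" using keys by blast
    then show ?thesis by (simp add: in_keys_iff)
  qed
  then obtain W where "poly_at G x (E ^ j - E ^ i) = poly_at G x (of_nat (ord x) * W)"
    using poly_at_divisible[OF x n] by metis
  then show ?thesis using ij(2) that[of "j - i" i W] by (simp add: poly_at_diff)
qed

text \<open>The element \<open>\<epsilon> = 1 - x\<close> divides both factors of \<open>\<theta> = (1 - x\<^sup>k)(1 - x\<^sup>m)\<close>. As \<open>m (1 - x\<^sup>k)\<close> is a
  multiple of \<open>(1 - x\<^sup>k)\<^sup>2\<close> and \<open>k (1 - x\<^sup>m)\<close> one of \<open>(1 - x\<^sup>m)\<^sup>2\<close>, both \<open>m \<theta>\<close> and \<open>k \<theta>\<close> are multiples of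
  \<open>\<epsilon> \<theta>\<close>, and so is \<open>\<theta>\<close> by Bezout: \<open>\<epsilon>\<close> is invertible modulo the annihilator of \<open>\<theta>\<close>. Thus some power
  \<open>\<epsilon>\<^sup>d\<close> acts on \<open>\<theta>\<close> as a unit \<open>1 + \<theta> t\<close> of the residue. If this unit were \<open>1\<close>, substituting a
  primitive root of unity \<open>\<zeta>\<close> for \<open>x\<close> would give \<open>(1 - \<zeta>)\<^sup>d = 1\<close>, contradicting \<open>\<bar>1 - \<zeta>\<bar> < 1\<close>.\<close>

lemma nontrivial_residue_of_cyclic:
  assumes x: "x \<in> carrier G" "ord x = m * k" and cop: "coprime m k"
    and big: "m \<ge> 2" "k \<ge> 2" "m * k \<noteq> 6"
  shows "delta_adic_residue G \<noteq> {frag_of \<one>}"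
proof
  assume res: "delta_adic_residue G = {frag_of \<one>}"
  let ?n = "m * k"
  have n: "?n > 0" "m < ?n" "k < ?n" using big by auto
  have n6: "?n > 6"
  proof (rule ccontr)
    assume "\<not> ?n > 6"
    then have "m * k \<le> 6" by simp
    moreover have "m * 2 \<le> m * k" "2 * k \<le> m * k" using big by (intro mult_le_mono; simp)+
    ultimately have "m \<le> 3" "k \<le> 3" by linarith+
    then have "m = 2 \<or> m = 3" "k = 2 \<or> k = 3" using big by linarith+
    then show False using cop big by auto
  qed
  define Y :: "int poly" where "Y = Polynomial.monom 1 1"
  define \<epsilon> where "\<epsilon> = 1 - Y"
  define A where "A = 1 - Y ^ k"
  define B where "B = 1 - Y ^ m"
  define \<theta> where "\<theta> = A * B"
  define T where "T = 1 - Y ^ ?n"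
  define \<alpha> where "\<alpha> = (\<Sum>i<k. Y ^ i)"
  define \<beta> where "\<beta> = (\<Sum>i<m. Y ^ i)"
  define c where "c = (\<Sum>i<m. \<Sum>j<i. (Y ^ k) ^ j)"
  define c' where "c' = (\<Sum>i<k. \<Sum>j<i. (Y ^ m) ^ j)"
  define I where "I = {P. poly_at G x P = 0}"
  have Ypow: "poly_at G x (Y ^ i) = frag_of (x [^] i)" for i :: nat
    by (simp add: Y_def monom_power)
  have T: "T \<in> I"
    using x pow_ord_eq_1[OF x(1)] by (simp add: I_def T_def poly_at_diff Ypow)
  have A: "A = \<epsilon> * \<alpha>" and B: "B = \<epsilon> * \<beta>"
    by (simp_all add: A_def B_def \<epsilon>_def \<alpha>_def \<beta>_def one_diff_power_eq)
  have mA: "of_nat m * A = A\<^sup>2 * c + T"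
    using of_nat_mult_one_minus[of m "Y ^ k"] by (simp add: A_def c_def T_def power_mult mult.commute flip: power_mult)
  have kB: "of_nat k * B = B\<^sup>2 * c' + T"
    using of_nat_mult_one_minus[of k "Y ^ m"] by (simp add: B_def c'_def T_def flip: power_mult)
  obtain u v where uv: "u * int m + v * int k = 1"
    using cop by (metis bezout_int coprime_iff_gcd_eq_1 coprime_int_iff)
  then have uv': "of_int u * of_nat m + of_int v * of_nat k = (1 :: int poly)"
    by (metis of_int_1 of_int_add of_int_mult of_int_of_nat_eq)
  define \<delta> where "\<delta> = of_int u * \<alpha> * c + of_int v * \<beta> * c'"
  have I_add: "p + q \<in> I" if "p \<in> I" "q \<in> I" for p q
    using that by (simp add: I_def poly_at_add)
  have I_mult: "q * p \<in> I" if "p \<in> I" for p q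
    using that x by (simp add: I_def poly_at_mult)
  have tors: "p \<in> I" if "of_nat ?n * p \<in> I" for p
    using that n by (simp add: I_def of_nat_poly poly_at_smult)
  have "\<epsilon> * \<delta> * \<theta> = of_int u * B * (A\<^sup>2 * c) + of_int v * A * (B\<^sup>2 * c')"
    by (simp add: \<delta>_def \<theta>_def A B power2_eq_square algebra_simps)
  also have "\<dots> = of_int u * B * (of_nat m * A - T) + of_int v * A * (of_nat k * B - T)"
    by (simp add: mA kB)
  also have "\<dots> = (of_int u * of_nat m + of_int v * of_nat k) * \<theta> - (of_int u * B + of_int v * A) * T"
    by (simp add: \<theta>_def algebra_simps)
  finally have "\<epsilon> * \<delta> * \<theta> - \<theta> = - (of_int u * B + of_int v * A) * T"
    by (simp only: uv')
  then have eps: "\<epsilon> * \<delta> * \<theta> - \<theta> \<in> I" using I_mult[OF T] by metis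
  have "of_nat ?n * \<theta> = (of_nat m * A) * (of_nat k * B)" by (simp add: \<theta>_def algebra_simps)
  also have "\<dots> = (A\<^sup>2 * c + T) * (B\<^sup>2 * c' + T)" by (simp only: mA kB)
  finally have "of_nat ?n * \<theta> - \<theta>\<^sup>2 * (c * c') = (A\<^sup>2 * c + B\<^sup>2 * c' + T) * T"
    by (simp add: \<theta>_def power2_eq_square algebra_simps)
  then have cc: "of_nat ?n * \<theta> - \<theta>\<^sup>2 * (c * c') \<in> I" using I_mult[OF T] by metis
  obtain j d W where d: "d > 0" and W: "\<epsilon> ^ (j + d) - \<epsilon> ^ j - of_nat ?n * W \<in> I"
  proof -
    obtain j d W where "d > 0" "poly_at G x (\<epsilon> ^ (j + d) - \<epsilon> ^ j - of_nat (ord x) * W) = 0"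
      using poly_at_power_pigeonhole[OF x(1), of \<epsilon>] x(2) n(1) by metis
    then show ?thesis using that[of d j W] x(2) by (simp only: I_def mem_Collect_eq)
  qed
  obtain t t' where inv: "(1 + \<theta> * t) * (1 + \<theta> * t') - 1 \<in> I"
    and U: "(1 + \<theta> * t) * \<theta> - \<epsilon> ^ d * \<theta> \<in> I"
    using lift_unit_modulo_annihilator[of I ?n, OF I_add I_mult tors eps cc W] by blast
  let ?U = "poly_at G x (1 + \<theta> * t)" and ?V = "poly_at G x (1 + \<theta> * t')"
  have "?U \<star> ?V = frag_of \<one>" "?V \<star> ?U = frag_of \<one>"
    using inv x by (simp_all add: I_def poly_at_diff mult.commute flip: poly_at_mult)
  then have unit: "?U \<in> Units ZG" using x by (intro Units_ZG_I[of _ ?V]) simp_all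
  have "(x [^] k) [^] m = \<one>" "(x [^] m) [^] k = \<one>"
    using x pow_ord_eq_1[OF x(1)] by (simp_all add: nat_pow_pow mult.commute)
  then have "(frag_of (x [^] k) - frag_of \<one>) \<star> (frag_of (x [^] m) - frag_of \<one>) \<in> \<Delta> i" for i
    using coprime_torsion_mult_mem_\<Delta>[of "x [^] k" m "x [^] m" k] x cop by simp
  moreover have "poly_at G x \<theta> = (frag_of (x [^] k) - frag_of \<one>) \<star> (frag_of (x [^] m) - frag_of \<one>)"
    using x by (simp add: \<theta>_def A_def B_def poly_at_mult poly_at_diff Ypow mult_distribs)
  ultimately have "?U - frag_of \<one> \<in> \<Delta> i" for i
    using x by (simp add: poly_at_add poly_at_mult \<Delta>_mult_right)
  then have "?U = frag_of \<one>"
    using unit res delta_adic_residue_iff by (metis singletonD)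
  then have eq: "poly_at G x (\<epsilon> ^ d * \<theta>) = poly_at G x \<theta>"
    using U x by (simp add: I_def poly_at_diff poly_at_mult)
  define \<zeta> where "\<zeta> = cis (2 * pi / real ?n)"
  have "\<zeta> ^ ?n = 1" using n(1) by (simp add: \<zeta>_def DeMoivre)
  have "poly (map_poly of_int (\<epsilon> ^ d * \<theta>)) \<zeta> = poly (map_poly of_int \<theta>) \<zeta>"
    using poly_at_determines_value[OF x(1) _ eq, of \<zeta>] \<open>\<zeta> ^ ?n = 1\<close> x by simp
  then have "(1 - \<zeta>) ^ d * ((1 - \<zeta> ^ k) * (1 - \<zeta> ^ m)) = (1 - \<zeta> ^ k) * (1 - \<zeta> ^ m)"
    by (simp add: \<epsilon>_def \<theta>_def A_def B_def Y_def complex_value_simps monom_power)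
  moreover have "\<zeta> ^ k \<noteq> 1" "\<zeta> ^ m \<noteq> 1"
    unfolding \<zeta>_def using root_of_unity_power_neq_one[of _ ?n] n big by auto
  ultimately have "(1 - \<zeta>) ^ d = 1" by simp
  then have "cmod (1 - \<zeta>) ^ d = 1" by (metis norm_one norm_power)
  moreover have "cmod (1 - \<zeta>) ^ d < 1"
    using norm_one_minus_root_of_unity_less_one[OF n6] d unfolding \<zeta>_def
    by (intro power_less_one_iff[THEN iffD2]) auto
  ultimately show False by simp
qed

end

section \<open>The residue of a \<open>p\<close>-group\<close>

lemma (in group) group_actionI:
  assumes closed: "\<And>g x. g \<in> carrier G \<Longrightarrow> x \<in> E \<Longrightarrow> f g x \<in> E"
    and one: "\<And>x. x \<in> E \<Longrightarrow> f \<one> x = x"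
    and mult: "\<And>g h x. g \<in> carrier G \<Longrightarrow> h \<in> carrier G \<Longrightarrow> x \<in> E \<Longrightarrow> f (g \<otimes> h) x = f g (f h x)"
  shows "group_action G E (\<lambda>g. restrict (f g) E)"
proof -
  have bij: "bij_betw (restrict (f g) E) E E" if g: "g \<in> carrier G" for g
    by (rule bij_betwI[where g = "f (inv g)"])
       (use g closed in \<open>auto simp: mult[symmetric] one\<close>)
  have "group_hom G (BijGroup E) (\<lambda>g. restrict (f g) E)"
    by (intro group_hom.intro group_hom_axioms.intro homI is_group group_BijGroup)
       (use bij closed in \<open>auto simp: BijGroup_def Bij_def mult compose_def fun_eq_iff\<close>)
  then show ?thesis by (rule group_action.intro)
qed

text \<open>Every orbit with more than one element has size divisible by \<open>p\<close>, so the number of fixed points is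
  divisible by \<open>p\<close> and cannot be one.\<close>

lemma (in group_action) second_fixed_point:
  assumes fin: "finite E" and p: "p dvd card E" "p > (1 :: nat)"
    and G: "\<And>d. d dvd Coset.order G \<Longrightarrow> d = 1 \<or> p dvd d"
    and x0: "x0 \<in> E" "\<And>g. g \<in> carrier G \<Longrightarrow> \<phi> g x0 = x0"
  obtains x where "x \<in> E" "x \<noteq> x0" "\<And>g. g \<in> carrier G \<Longrightarrow> \<phi> g x = x"
proof (rule ccontr)
  assume neg: "\<not> thesis"
  note fixed_point = that
  let ?O = "orbits G E \<phi>"
  have O: "finite ?O" unfolding orbits_def using fin by simp
  have "orbit G \<phi> x0 = {x0}"
    using x0 orbit_refl[OF x0(1)] by (auto simp: orbit_def)
  then have x0O: "{x0} \<in> ?O" using x0(1) by (force simp: orbits_def)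
  have "p dvd card b" if b: "b \<in> ?O - {{x0}}" for b
  proof -
    obtain x where x: "x \<in> E" "b = orbit G \<phi> x" using b by (auto simp: orbits_def)
    have "card b dvd Coset.order G" using orbit_stabilizer_theorem[OF x(1)] x(2) by (metis dvd_triv_left)
    moreover have "card b \<noteq> 1"
    proof
      assume "card b = 1"
      then have bx: "b = {x}" using orbit_refl[OF x(1)] x(2) by (metis card_1_singletonE singletonD)
      then have "\<And>g. g \<in> carrier G \<Longrightarrow> \<phi> g x = x" using x(2) by (auto simp: orbit_def)
      then show False using neg fixed_point[of x] x(1) bx b by blast
    qed
    ultimately show ?thesis using G by blast
  qed
  then have "p dvd (\<Sum>b\<in>?O - {{x0}}. card b)" by (rule dvd_sum)
  moreover have "(\<Sum>b\<in>?O. \<Sum>x\<in>b. 1 :: nat) = (\<Sum>x\<in>E. 1)"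
    using fin by (rule disjoint_sum)
  then have "card E = (\<Sum>b\<in>?O. card b)" by simp
  then have "card E = 1 + (\<Sum>b\<in>?O - {{x0}}. card b)"
    using sum.remove[OF O x0O, of card] by simp
  ultimately have "p dvd 1" using p(1) by (metis dvd_add_left_iff)
  then show False using p(2) by simp
qed

text \<open>By Sylow's theorem a prime divisor of the group order is the order of an element.\<close>

lemma (in group) p_group_dvd_order:
  assumes fin: "finite (carrier G)" and p: "Factorial_Ring.prime p" "p_group p G"
    and d: "d dvd Coset.order G"
  shows "d = 1 \<or> p dvd d"
proof (cases "d = 1")
  case False
  then obtain q where q: "Factorial_Ring.prime q" "q dvd d" using prime_factor_nat by blast
  obtain m where "Coset.order G = q ^ 1 * m" using dvd_trans[OF q(2) d] by auto
  then obtain H where H: "subgroup H G" "card H = q ^ 1"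
    using sylow_thm[OF _ is_group _ fin] q(1) by (metis Primes.prime_nat_iff prime_nat_iff)
  have "H \<noteq> {\<one>}" using H(2) prime_gt_1_nat[OF q(1)] by auto
  then obtain h where h: "h \<in> H" "h \<noteq> \<one>" using subgroup.one_closed[OF H(1)] by blast
  have hG: "h \<in> carrier G" using subgroup.mem_carrier[OF H(1) h(1)] .
  interpret K: group "G\<lparr>carrier := H\<rparr>" using subgroup.subgroup_is_group[OF H(1) is_group] .
  have "h [^] card H = \<one>"
    using K.pow_order_eq_1[of h] h(1) by (simp add: Coset.order_def nat_pow_consistent[symmetric])
  then have "ord h dvd q" using H(2) hG by (simp add: pow_eq_id)
  moreover have "ord h \<noteq> 1" using ord_eq_1[OF hG] h(2) by simp
  ultimately have "ord h = q" using q(1) prime_nat_iff by blast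
  moreover obtain k where "ord h = p ^ k" using p(2) hG by (auto simp: p_group_def)
  ultimately have "q = p" using q(1) p(1) by (metis prime_dvd_power_nat dvd_refl primes_dvd_imp_eq)
  then show ?thesis using q(2) by simp
qed simp

context group
begin

text \<open>The left ideals of \<open>\<int>G\<close> containing \<open>p\<int>G\<close>.\<close>

definition stable_lattice :: "nat \<Rightarrow> ('a \<Rightarrow>\<^sub>0 int) set \<Rightarrow> bool" where
  "stable_lattice p L \<longleftrightarrow> L \<subseteq> carrier ZG \<and> (\<forall>a\<in>L. \<forall>b\<in>L. a - b \<in> L) \<and>
     (\<forall>g\<in>carrier G. \<forall>a\<in>L. frag_of g \<star> a \<in> L) \<and> (\<forall>a\<in>carrier ZG. frag_cmul (int p) a \<in> L)"

lemma stable_latticeD: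
  assumes "stable_lattice p L"
  shows "a \<in> L \<Longrightarrow> a \<in> carrier ZG" "a \<in> L \<Longrightarrow> b \<in> L \<Longrightarrow> a - b \<in> L"
    "g \<in> carrier G \<Longrightarrow> a \<in> L \<Longrightarrow> frag_of g \<star> a \<in> L"
    "a \<in> carrier ZG \<Longrightarrow> frag_cmul (int p) a \<in> L"
  using assms unfolding stable_lattice_def by blast+

lemma stable_lattice_zero: "stable_lattice p L \<Longrightarrow> 0 \<in> L"
  using stable_latticeD(4)[of p L 0] by simp

lemma stable_lattice_minus: "stable_lattice p L \<Longrightarrow> a \<in> L \<Longrightarrow> - a \<in> L"
  using stable_latticeD(2)[of p L 0 a] stable_lattice_zero by simp

lemma stable_lattice_add: "stable_lattice p L \<Longrightarrow> a \<in> L \<Longrightarrow> b \<in> L \<Longrightarrow> a + b \<in> L"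
  using stable_latticeD(2)[of p L a "- b"] stable_lattice_minus by simp

lemma stable_lattice_cmul: "stable_lattice p L \<Longrightarrow> a \<in> L \<Longrightarrow> frag_cmul k a \<in> L"
  by (rule frag_closure_minus_cmul) (auto intro: stable_lattice_zero stable_latticeD(2))

lemma stable_lattice_sum: "stable_lattice p L \<Longrightarrow> (\<And>i. i \<in> I \<Longrightarrow> f i \<in> L) \<Longrightarrow> sum f I \<in> L"
  by (induction I rule: infinite_finite_induct) (auto intro: stable_lattice_zero stable_lattice_add)

text \<open>Representatives of \<open>\<int>G\<close> modulo \<open>p\<int>G\<close>.\<close>

definition reduced_elements :: "nat \<Rightarrow> ('a \<Rightarrow>\<^sub>0 int) set" where
  "reduced_elements p = {a \<in> carrier ZG. \<forall>g. Poly_Mapping.lookup a g \<in> {0..<int p}}"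

lemma finite_reduced_elements:
  assumes "finite (carrier G)"
  shows "finite (reduced_elements p)"
proof (rule finite_imageD)
  let ?f = "\<lambda>a. restrict (Poly_Mapping.lookup a) (carrier G)"
  have "?f ` reduced_elements p \<subseteq> Pi\<^sub>E (carrier G) (\<lambda>_. {0..<int p})"
    by (auto simp: reduced_elements_def)
  then show "finite (?f ` reduced_elements p)"
    by (rule finite_subset) (use assms in \<open>auto intro: finite_PiE\<close>)
  show "inj_on ?f (reduced_elements p)"
  proof (rule inj_onI)
    fix a b assume ab: "a \<in> reduced_elements p" "b \<in> reduced_elements p" "?f a = ?f b"
    show "a = b"
    proof (rule poly_mapping_eqI)
      fix g
      show "Poly_Mapping.lookup a g = Poly_Mapping.lookup b g"
      proof (cases "g \<in> carrier G")
        case True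
        then show ?thesis using fun_cong[OF ab(3), of g] by simp
      next
        case False
        then have "g \<notin> Poly_Mapping.keys a" "g \<notin> Poly_Mapping.keys b"
          using ab by (auto simp: reduced_elements_def mem_ZG_iff)
        then show ?thesis by (simp add: in_keys_iff)
      qed
    qed
  qed
qed

lemma ZG_reduce:
  assumes a: "a \<in> carrier ZG" and p: "p > 0"
  obtains r c where "r \<in> reduced_elements p" "c \<in> carrier ZG" "a = r + frag_cmul (int p) c"
proof
  let ?r = "Poly_Mapping.map (\<lambda>k. k mod int p) a" and ?c = "Poly_Mapping.map (\<lambda>k. k div int p) a"
  show "a = ?r + frag_cmul (int p) ?c"
    by (rule poly_mapping_eqI) (simp add: lookup_add Poly_Mapping.map.rep_eq when_def)
  show "?r \<in> reduced_elements p" "?c \<in> carrier ZG"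
    using a p by (auto simp: reduced_elements_def mem_ZG_iff in_keys_iff Poly_Mapping.map.rep_eq when_def
        split: if_splits)
qed

text \<open>The quotient of \<open>\<int>G\<close> by \<open>L\<close> is a nontrivial finite group killed by \<open>p\<close>, so \<open>p\<close> divides its size.
  The \<open>p\<close>-group \<open>G\<close> acts on it by left multiplication and fixes \<open>0\<close>, hence also a second coset.\<close>

lemma stable_lattice_invariant_vector:
  assumes fin: "finite (carrier G)" and p: "Factorial_Ring.prime p" "p_group p G"
    and L: "stable_lattice p L" "L \<noteq> carrier ZG"
  obtains v where "v \<in> carrier ZG" "v \<notin> L" "\<And>g. g \<in> carrier G \<Longrightarrow> frag_of g \<star> v - v \<in> L"
proof -
  let ?M = "add_monoid ZG"
  note L = stable_latticeD[OF L(1)] L stable_lattice_zero[OF L(1)] stable_lattice_minus[OF L(1)]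
    stable_lattice_add[OF L(1)]
  have cg: "comm_group ?M"
    using ring.is_abelian_group[OF ring_group_ring] by (rule abelian_group.a_comm_group)
  interpret M: comm_group ?M by (rule cg)
  have inv: "inv\<^bsub>?M\<^esub> a = - a" if "a \<in> carrier ZG" for a
    using that by (intro M.inv_equality) auto
  have "subgroup L ?M"
    by (rule M.subgroupI) (use L inv in auto)
  then have "normal L ?M" by (rule M.subgroup_imp_normal)
  then interpret N: normal L ?M .
  define cs where "cs v = (\<lambda>a. a + v) ` L" for v
  have rc: "r_coset ?M L v = cs v" for v by (auto simp: r_coset_def cs_def)
  have cs_eq: "cs v = cs w \<longleftrightarrow> v - w \<in> L" for v w
  proof
    assume "cs v = cs w"
    moreover have "v \<in> cs v" using L(7) by (force simp: cs_def)
    ultimately obtain a where "a \<in> L" "v = a + w" by (auto simp: cs_def)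
    then show "v - w \<in> L" by simp
  next
    assume vw: "v - w \<in> L"

    have "a + v \<in> cs w" "a + w \<in> cs v" if "a \<in> L" for a
      unfolding cs_def using that L(2,9) vw
      by (auto intro: image_eqI[of _ _ "a + (v - w)"] image_eqI[of _ _ "a - (v - w)"])
    then show "cs v = cs w" by (auto simp: cs_def[of v] cs_def[of w])
  qed
  define E where "E = cs ` carrier ZG"
  have E: "carrier (?M Mod L) = E" by (simp only: carrier_FactGroup E_def rc) simp
  have finE: "finite E"
  proof (rule finite_subset)
    show "E \<subseteq> cs ` reduced_elements p"
    proof
      fix Y assume "Y \<in> E"
      then obtain a where a: "a \<in> carrier ZG" "Y = cs a" by (auto simp: E_def)
      obtain r c where rc: "r \<in> reduced_elements p" "c \<in> carrier ZG" "a = r + frag_cmul (int p) c"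
        using ZG_reduce[OF a(1)] p(1) prime_gt_0_nat by blast
      then have "cs a = cs r" using L by (simp add: cs_eq)
      then show "Y \<in> cs ` reduced_elements p" using a rc by blast
    qed
  qed (simp add: finite_reduced_elements[OF fin])
  obtain w where w: "w \<in> carrier ZG" "w \<notin> L" using L by blast
  interpret Q: group "?M Mod L" by (rule N.factorgroup_is_group)
  have pow: "w [^]\<^bsub>?M\<^esub> n = frag_cmul (int n) w" for n :: nat
    by (induction n) (use w in \<open>auto simp: frag_cmul_distrib add.commute\<close>)
  have "cs w [^]\<^bsub>?M Mod L\<^esub> p = cs (frag_cmul (int p) w)"
  proof -
    have "w \<in> carrier ?M" using w(1) by simp
    from N.FactGroup_pow[OF this, of p] show ?thesis by (simp only: rc pow)
  qed
  also have "\<dots> = cs 0" using w L by (simp add: cs_eq)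
  also have "\<dots> = \<one>\<^bsub>?M Mod L\<^esub>" by (simp add: cs_def)
  finally have "cs w [^]\<^bsub>?M Mod L\<^esub> p = \<one>\<^bsub>?M Mod L\<^esub>" .
  moreover have csw: "cs w \<in> carrier (?M Mod L)" unfolding E E_def using w(1) by blast
  ultimately have "Q.ord (cs w) dvd p" by (metis Q.pow_eq_id)
  moreover have "Q.ord (cs w) \<noteq> 1"
  proof
    assume "Q.ord (cs w) = 1"
    then have "cs w = L" using Q.ord_eq_1[OF csw] by simp
    then show False using w cs_eq[of w 0] by (simp add: cs_def)
  qed
  ultimately have "Q.ord (cs w) = p" using p(1) prime_nat_iff by blast
  then have pE: "p dvd card E"
    using Q.ord_dvd_group_order[OF csw] unfolding Coset.order_def E by simp
  define act where "act g Y = (\<lambda>a. frag_of g \<star> a) ` Y" for g Y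
  have act: "act g (cs v) = cs (frag_of g \<star> v)" if g: "g \<in> carrier G" and v: "v \<in> carrier ZG" for g v
  proof -
    have "(\<lambda>a. frag_of g \<star> a) ` L = L"
    proof
      show "L \<subseteq> (\<lambda>a. frag_of g \<star> a) ` L"
      proof
        fix a assume a: "a \<in> L"
        have "a = frag_of g \<star> (frag_of (inv g) \<star> a)"
          using g L(1)[OF a] by (simp add: mult_assoc[symmetric])
        then show "a \<in> (\<lambda>a. frag_of g \<star> a) ` L" using L(3)[OF inv_closed[OF g] a] by (rule image_eqI)
      qed
    qed (use L(3)[OF g] in blast)
    moreover have "act g (cs v) = (\<lambda>a. a + frag_of g \<star> v) ` (\<lambda>a. frag_of g \<star> a) ` L"
      by (auto simp: act_def cs_def image_image mult_add_right)
    ultimately show ?thesis by (simp add: cs_def)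
  qed
  have "group_action G E (\<lambda>g. restrict (act g) E)"
  proof (rule group_actionI)
    fix g h Y assume gh: "g \<in> carrier G" "h \<in> carrier G" and "Y \<in> E"
    then obtain v where v: "v \<in> carrier ZG" "Y = cs v" by (auto simp: E_def)
    have "frag_of (g \<otimes> h) \<star> v = frag_of g \<star> (frag_of h \<star> v)"
      using gh v by (simp only: mult_frag_of[symmetric] mult_assoc frag_of_mem_ZG)
    then show "act (g \<otimes> h) Y = act g (act h Y)" using gh v by (simp add: act)
  qed (auto simp: E_def act)
  then interpret A: group_action G E "\<lambda>g. restrict (act g) E" .
  obtain Y where Y: "Y \<in> E" "Y \<noteq> cs 0" "\<And>g. g \<in> carrier G \<Longrightarrow> restrict (act g) E Y = Y"
    using A.second_fixed_point[of p "cs 0"] finE pE p_group_dvd_order[OF fin p] prime_gt_1_nat[OF p(1)]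
    by (auto simp: act E_def)
  then obtain v where v: "v \<in> carrier ZG" "Y = cs v" by (auto simp: E_def)
  show ?thesis
  proof (rule that[of v])
    show "v \<notin> L" using Y v by (simp add: cs_eq)
    show "frag_of g \<star> v - v \<in> L" if "g \<in> carrier G" for g
      using Y(3)[OF that] Y(1) v that by (simp add: act cs_eq)
  qed fact
qed

text \<open>The preimages in \<open>\<int>G\<close> of the ascending series of submodules of \<open>\<int>G / p\<int>G\<close> in which each
  step adds the vectors that \<open>G\<close> fixes modulo the preceding term. The augmentation ideal maps each term
  into the preceding one.\<close>

primrec socle_series :: "nat \<Rightarrow> nat \<Rightarrow> ('a \<Rightarrow>\<^sub>0 int) set" where
  "socle_series p 0 = frag_cmul (int p) ` carrier ZG"
| "socle_series p (Suc n) =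
     {v \<in> carrier ZG. \<forall>g\<in>carrier G. frag_of g \<star> v - v \<in> socle_series p n}"

lemma stable_lattice_socle_series: "stable_lattice p (socle_series p n)"
proof (induction n)
  case 0
  have "frag_cmul (int p) a - frag_cmul (int p) b \<in> frag_cmul (int p) ` carrier ZG"
    if "a \<in> carrier ZG" "b \<in> carrier ZG" for a b
    using that by (simp flip: frag_cmul_diff_right)
  then show ?case by (auto simp: stable_lattice_def mult_cmul_right)
next
  case (Suc n)
  show ?case unfolding stable_lattice_def
  proof (intro conjI ballI)
    fix a b assume ab: "a \<in> socle_series p (Suc n)" "b \<in> socle_series p (Suc n)"
    have *: "frag_of g \<star> (a - b) - (a - b) = (frag_of g \<star> a - a) - (frag_of g \<star> b - b)" for g
      by (simp add: mult_diff_right)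
    show "a - b \<in> socle_series p (Suc n)" using ab stable_latticeD(2)[OF Suc] by (auto simp: *)
  next
    fix h a assume h: "h \<in> carrier G" and a: "a \<in> socle_series p (Suc n)"
    have "frag_of g \<star> (frag_of h \<star> a) - frag_of h \<star> a \<in> socle_series p n" if g: "g \<in> carrier G" for g
    proof -
      let ?k = "inv h \<otimes> g \<otimes> h"
      have "h \<otimes> ?k = g \<otimes> h" using g h by (simp flip: m_assoc)
      then have "frag_of g \<star> (frag_of h \<star> a) - frag_of h \<star> a = frag_of h \<star> (frag_of ?k \<star> a - a)"
        using g h a by (simp add: mult_diff_right flip: mult_assoc)
      then show ?thesis using stable_latticeD(3)[OF Suc h] a g h by auto
    qed
    then show "frag_of h \<star> a \<in> socle_series p (Suc n)" using h a by simp
  next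
    fix a assume a: "a \<in> carrier ZG"
    have "frag_of g \<star> frag_cmul (int p) a - frag_cmul (int p) a = frag_cmul (int p) (frag_of g \<star> a - a)" for g
      by (simp add: mult_cmul_right frag_cmul_diff_right)
    then show "frag_cmul (int p) a \<in> socle_series p (Suc n)" using a stable_latticeD(4)[OF Suc] by simp
  qed auto
qed

text \<open>As long as a term is proper, the next one contains a new fixed vector, which may be chosen among
  the finitely many reduced elements.\<close>

lemma socle_series_eventually_everything:
  assumes fin: "finite (carrier G)" and p: "Factorial_Ring.prime p" "p_group p G"
  shows "\<exists>n. socle_series p n = carrier ZG"
proof (rule ccontr)
  assume neg: "\<nexists>n. socle_series p n = carrier ZG"
  let ?F = "reduced_elements p"
  have mono: "socle_series p n \<subseteq> socle_series p (Suc n)" for n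
    using stable_latticeD[OF stable_lattice_socle_series[of p n]] by auto
  have "n \<le> card (?F \<inter> socle_series p n)" for n
  proof (induction n)
    case (Suc n)
    obtain v where v: "v \<in> carrier ZG" "v \<notin> socle_series p n" "\<And>g. g \<in> carrier G \<Longrightarrow> frag_of g \<star> v - v \<in> socle_series p n"
      using stable_lattice_invariant_vector[OF fin p stable_lattice_socle_series] neg by metis
    obtain r c where rc: "r \<in> ?F" "c \<in> carrier ZG" "v = r + frag_cmul (int p) c"
      using ZG_reduce[OF v(1)] p(1) prime_gt_0_nat by blast
    have r: "r = v - frag_cmul (int p) c" using rc by simp
    have v': "v \<in> socle_series p (Suc n)" using v by simp
    have "r \<in> socle_series p (Suc n)"
      unfolding r using stable_latticeD(2,4)[OF stable_lattice_socle_series] v' rc(2) by blast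
    moreover have "r \<notin> socle_series p n"
      using stable_lattice_add[OF stable_lattice_socle_series] stable_latticeD(4)[OF stable_lattice_socle_series] rc v(2) by blast
    ultimately have "?F \<inter> socle_series p n \<subset> ?F \<inter> socle_series p (Suc n)" using mono[of n] rc(1) by blast
    then have "card (?F \<inter> socle_series p n) < card (?F \<inter> socle_series p (Suc n))"
      using finite_reduced_elements[OF fin] by (intro psubset_card_mono) auto
    then show ?case using Suc by linarith
  qed simp
  then have "Suc (card ?F) \<le> card (?F \<inter> socle_series p (Suc (card ?F)))" .
  also have "\<dots> \<le> card ?F" using finite_reduced_elements[OF fin] by (intro card_mono) auto
  finally show False by simp
qed

lemma augmentation_ideal_socle_series:
  assumes d: "d \<in> augmentation_ideal G" and v: "v \<in> socle_series p (Suc n)"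
  shows "d \<star> v \<in> socle_series p n"
proof -
  have dc: "Poly_Mapping.keys d \<subseteq> carrier G" using d by (simp add: augmentation_ideal_iff mem_ZG_iff)
  have "d \<star> v = (\<Sum>g\<in>Poly_Mapping.keys d. frag_cmul (Poly_Mapping.lookup d g) ((frag_of g - frag_of \<one>) \<star> v))"
    by (subst augmentation_ideal_expansion[OF d]) (simp add: mult_sum_left mult_cmul_left)
  also have "\<dots> \<in> socle_series p n"
    using v dc by (intro stable_lattice_sum[OF stable_lattice_socle_series] stable_lattice_cmul[OF stable_lattice_socle_series])
      (auto simp: mult_diff_left)
  finally show ?thesis .
qed

text \<open>Each factor from the augmentation ideal moves \<open>v\<close> one step down the series; after \<open>m\<close> steps
  it lies in \<open>p\<int>G\<close>, and the remaining factor in \<open>\<Delta> n\<close> supplies \<open>p\<^sup>k\<close>.\<close>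

lemma \<Delta>_socle_series:
  assumes \<Delta>: "\<Delta> n \<subseteq> frag_cmul (int (p ^ k)) ` carrier ZG"
  shows "d \<in> \<Delta> (n + m) \<Longrightarrow> v \<in> socle_series p m \<Longrightarrow> d \<star> v \<in> frag_cmul (int (p ^ Suc k)) ` carrier ZG"
proof (induction m arbitrary: d v)
  case 0
  obtain a where a: "a \<in> carrier ZG" "d = frag_cmul (int (p ^ k)) a" using 0 \<Delta> by auto
  obtain b where b: "b \<in> carrier ZG" "v = frag_cmul (int p) b" using 0 by auto
  have "d \<star> v = frag_cmul (int (p ^ Suc k)) (a \<star> b)"
    using a b by (simp add: mult_cmul_left mult_cmul_right mult.commute)
  then show ?case using a b by simp
next
  case (Suc m)
  have v: "v \<in> carrier ZG" using Suc.prems(2) by simp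
  have "d \<in> \<Delta> (Suc (n + m))" using Suc.prems(1) by simp
  then show ?case
  proof (induction rule: \<Delta>_Suc_induct)
    case (mult x y)
    then have "x \<star> (y \<star> v) \<in> frag_cmul (int (p ^ Suc k)) ` carrier ZG"
      using Suc.IH augmentation_ideal_socle_series Suc.prems(2) by blast
    then show ?case using mult \<Delta>_carrier[of x] v by (simp add: mult_assoc augmentation_ideal_iff)
  next
    case (add x y)
    then obtain a b where "a \<in> carrier ZG" "b \<in> carrier ZG"
      "x \<star> v = frag_cmul (int (p ^ Suc k)) a" "y \<star> v = frag_cmul (int (p ^ Suc k)) b" by auto
    then have "(x + y) \<star> v = frag_cmul (int (p ^ Suc k)) (a + b)" "a + b \<in> carrier ZG"
      by (simp_all add: mult_add_left frag_cmul_distrib2)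
    then show ?case by blast
  qed
qed

text \<open>Once the series reaches \<open>\<int>G\<close> at the \<open>N\<close>-th step, each further \<open>N\<close> factors gain a factor \<open>p\<close>.
  The powers of the augmentation ideal thus lie in ever smaller multiples \<open>p\<^sup>k\<int>G\<close>, and their
  intersection is zero.\<close>

theorem p_group_residue_trivial:
  assumes fin: "finite (carrier G)" and p: "Factorial_Ring.prime p" "p_group p G"
  shows "delta_adic_residue G = {frag_of \<one>}"
proof -
  obtain N where N: "socle_series p N = carrier ZG"
    using socle_series_eventually_everything[OF assms] by blast
  have pow: "\<exists>n. \<Delta> n \<subseteq> frag_cmul (int (p ^ k)) ` carrier ZG" for k
  proof (induction k)
    case 0
    show ?case by (rule exI[of _ 0]) (auto intro!: image_eqI[of _ "frag_cmul 1"])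
  next
    case (Suc k)
    then obtain n where n: "\<Delta> n \<subseteq> frag_cmul (int (p ^ k)) ` carrier ZG" by blast
    have "d \<in> frag_cmul (int (p ^ Suc k)) ` carrier ZG" if "d \<in> \<Delta> (n + N)" for d
      using \<Delta>_socle_series[OF n that, of "frag_of \<one>"] N \<Delta>_carrier[OF that] by simp
    then show ?case by blast
  qed
  have "u = frag_of \<one>" if u: "u \<in> delta_adic_residue G" for u
  proof -
    have *: "int (p ^ k) dvd Poly_Mapping.lookup (u - frag_of \<one>) g" for g k
    proof -
      obtain n where n: "\<Delta> n \<subseteq> frag_cmul (int (p ^ k)) ` carrier ZG" using pow by blast
      moreover have "u - frag_of \<one> \<in> \<Delta> n" using u by (simp add: delta_adic_residue_iff)
      ultimately obtain a where "u - frag_of \<one> = frag_cmul (int (p ^ k)) a" by blast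
      then show ?thesis by simp
    qed
    have "Poly_Mapping.lookup (u - frag_of \<one>) g = 0" for g
    proof (rule ccontr)
      let ?x = "Poly_Mapping.lookup (u - frag_of \<one>) g"
      assume "?x \<noteq> 0"
      then have "int (p ^ nat \<bar>?x\<bar>) \<le> \<bar>?x\<bar>" using * by (metis dvd_imp_le_int zdvd_imp_le abs_of_nat)
      moreover have "nat \<bar>?x\<bar> < p ^ nat \<bar>?x\<bar>" using prime_gt_1_nat[OF p(1)] by (intro power_gt_expt) simp
      ultimately show False by linarith
    qed
    then have "u - frag_of \<one> = 0" by (intro poly_mapping_eqI) simp
    then show ?thesis by simp
  qed
  then show ?thesis using one_mem_residue by blast
qed

end

section \<open>Characters of finite abelian groups\<close>

context group
begin

definition character_on :: "'a set \<Rightarrow> ('a \<Rightarrow> complex) \<Rightarrow> bool" where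
  "character_on H \<chi> \<longleftrightarrow> \<chi> \<one> = 1 \<and> (\<forall>x\<in>H. \<forall>y\<in>H. \<chi> (x \<otimes> y) = \<chi> x * \<chi> y)"

lemma character_on_power:
  assumes "subgroup H G" "character_on H \<chi>" "x \<in> H"
  shows "\<chi> (x [^] (n :: nat)) = \<chi> x ^ n"
proof (induction n)
  case (Suc n)
  have "x [^] n \<in> H"
    using assms(1,3) by (induction n) (auto simp: subgroup.one_closed subgroup.m_closed)
  then show ?case using Suc assms by (simp add: character_on_def)
qed (use assms in \<open>simp add: character_on_def\<close>)

text \<open>Separation is stated for functions rather than group ring elements so that the property can be
  transferred to the cosets of a subgroup.\<close>

definition separated_by_characters :: "'a set \<Rightarrow> bool" where
  "separated_by_characters H \<longleftrightarrow> (\<forall>f :: 'a \<Rightarrow> complex.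
     (\<forall>\<chi>. character_on H \<chi> \<longrightarrow> (\<Sum>x\<in>H. f x * \<chi> x) = 0) \<longrightarrow> (\<forall>x\<in>H. f x = 0))"

end

context comm_group
begin

text \<open>Let \<open>n\<close> be minimal with \<open>x\<^sup>n \<in> H\<close>. A character \<open>\<chi>\<close> of \<open>H\<close> extends to \<open>H\<langle>x\<rangle>\<close> by sending \<open>x\<close> to
  any of the \<open>n\<close> roots \<open>\<zeta>\<close> of \<open>\<zeta>\<^sup>n = \<chi>(x\<^sup>n)\<close>. Splitting a function on \<open>H\<langle>x\<rangle>\<close> into its restrictions to the
  cosets \<open>H x\<^sup>i\<close> for \<open>i < n\<close>, its sums against these extensions are the values at the roots \<open>\<zeta>\<close> of a polynomial of
  degree less than \<open>n\<close>. If all of them vanish, so do the coefficients, which are the sums of the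
  restrictions against \<open>\<chi>\<close>.\<close>

lemma separated_by_characters_extend:
  assumes fin: "finite (carrier G)" and H: "subgroup H G" and x: "x \<in> carrier G" "x \<notin> H"
    and sep: "separated_by_characters H"
  shows "\<exists>H'. subgroup H' G \<and> H \<subset> H' \<and> separated_by_characters H'"
proof -
  have HG: "h \<in> H \<Longrightarrow> h \<in> carrier G" for h using subgroup.mem_carrier[OF H] .
  note Hc = subgroup.one_closed[OF H] subgroup.m_closed[OF H] subgroup.m_inv_closed[OF H]
  have Hpow: "h [^] (i :: nat) \<in> H" if "h \<in> H" for h i
    using that by (induction i) (auto simp: Hc)
  define n :: nat where "n = (LEAST n. 0 < n \<and> x [^] n \<in> H)"
  have "0 < Coset.order G \<and> x [^] Coset.order G \<in> H"
    using fin x pow_order_eq_1 Hc(1) by (simp add: order_gt_0_iff_finite)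
  then have "0 < n \<and> x [^] n \<in> H" unfolding n_def
    by (rule LeastI)
  then have n: "0 < n" "x [^] n \<in> H" by auto
  have n_least: "n \<le> i" if "0 < i" "x [^] i \<in> H" for i
    unfolding n_def using that by (simp add: Least_le)
  have split: "x [^] i = (x [^] n) [^] (i div n) \<otimes> x [^] (i mod n)" for i
  proof -
    have "x [^] i = x [^] (n * (i div n) + i mod n)" by simp
    then show ?thesis using x by (simp only: nat_pow_mult nat_pow_pow)
  qed
  have n_dvd: "n dvd i" if "x [^] i \<in> H" for i
  proof -
    have "x [^] (i mod n) = inv ((x [^] n) [^] (i div n)) \<otimes> x [^] i"
      using split[of i] x by (simp add: m_assoc[symmetric])
    also have "\<dots> \<in> H" using that n Hc Hpow by blast
    finally have "i mod n = 0" using n_least[of "i mod n"] n(1) by (meson mod_less_divisor not_less neq0_conv)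
    then show ?thesis by auto
  qed
  \<comment> \<open>The ambiguity in writing an element as \<open>h x\<^sup>i\<close>: powers of \<open>x\<^sup>n\<close> move between the factors.\<close>
  have cancel: "\<exists>q. j = i + n * q \<and> h = k \<otimes> (x [^] n) [^] q"
    if "h \<in> H" "k \<in> H" "h \<otimes> x [^] i = k \<otimes> x [^] j" "i \<le> j" for h k and i j :: nat
  proof -
    have "h \<otimes> x [^] i = (k \<otimes> x [^] (j - i)) \<otimes> x [^] i"
      using that x HG by (simp add: m_assoc nat_pow_mult)
    then have h: "h = k \<otimes> x [^] (j - i)" using that x HG by simp
    then have "x [^] (j - i) = inv k \<otimes> h" using that x HG by (simp add: m_assoc[symmetric])
    then have "n dvd j - i" using that Hc n_dvd by metis
    then obtain q where "j - i = n * q" by auto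
    then show ?thesis using h that x by (intro exI[of _ q]) (simp add: nat_pow_pow)
  qed
  define H' where "H' = (\<lambda>(h, i). h \<otimes> x [^] (i :: nat)) ` (H \<times> {..<n})"
  have H'I: "h \<otimes> x [^] i \<in> H'" if "h \<in> H" for h and i :: nat
  proof -
    have "h \<otimes> x [^] i = (h \<otimes> (x [^] n) [^] (i div n)) \<otimes> x [^] (i mod n)"
      by (subst split) (use that x HG n Hpow in \<open>simp add: m_assoc\<close>)
    then show ?thesis
      unfolding H'_def using that n Hpow Hc by (intro image_eqI[of _ _ "(h \<otimes> (x [^] n) [^] (i div n), i mod n)"]) auto
  qed
  have H'E: "\<exists>h\<in>H. \<exists>i<n. y = h \<otimes> x [^] i" if "y \<in> H'" for y
    using that by (auto simp: H'_def)
  have inj: "inj_on (\<lambda>(h, i). h \<otimes> x [^] (i :: nat)) (H \<times> {..<n})"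
  proof -
    have *: "h = k \<and> i = j"
      if hk: "h \<in> H" "k \<in> H" "h \<otimes> x [^] i = k \<otimes> x [^] j" "i \<le> j" "j < n" for h k and i j :: nat
    proof -
      obtain q where q: "j = i + n * q" "h = k \<otimes> (x [^] n) [^] q" using cancel[OF hk(1-4)] by blast
      then have "q = 0" using hk(5) by (cases q) auto
      then show ?thesis using q hk HG by simp
    qed
    show ?thesis
    proof (rule inj_onI, clarify)
      fix h i k j assume "h \<in> H" "k \<in> H" "i < n" "j < n" "h \<otimes> x [^] i = k \<otimes> x [^] (j :: nat)"
      then show "h = k \<and> i = j" using *[of h k i j] *[of k h j i] by (metis nat_le_linear)
    qed
  qed
  have H': "subgroup H' G"
  proof (rule subgroupI)
    show "H' \<subseteq> carrier G" using HG x by (auto simp: H'_def)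
    show "H' \<noteq> {}" using H'I[OF Hc(1)] by blast
  next
    fix y assume "y \<in> H'"
    then obtain h and i :: nat where y: "h \<in> H" "y = h \<otimes> x [^] i" using H'E by metis
    have "x [^] (i * (Coset.order G - 1)) \<otimes> x [^] i = x [^] (i * (Coset.order G - 1) + i)"
      using x by (simp add: nat_pow_mult)
    also have "i * (Coset.order G - 1) + i = Coset.order G * i"
      using fin order_gt_0_iff_finite by (cases "Coset.order G") auto
    also have "x [^] (Coset.order G * i) = \<one>" using x pow_order_eq_1 by (simp add: nat_pow_pow[symmetric])
    finally have "inv (x [^] i) = x [^] (i * (Coset.order G - 1))" using x by (intro inv_equality) auto
    then have "inv y = inv h \<otimes> x [^] (i * (Coset.order G - 1))"
      using y x HG by (simp add: inv_mult)
    then show "inv y \<in> H'" using H'I[OF Hc(3)] y by simp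
  next
    fix y z assume "y \<in> H'" "z \<in> H'"
    then obtain h k and i j :: nat where "h \<in> H" "k \<in> H" "y = h \<otimes> x [^] i" "z = k \<otimes> x [^] j"
      using H'E by metis
    moreover from this have "y \<otimes> z = (h \<otimes> k) \<otimes> x [^] (i + j)"
      using HG x by (simp add: nat_pow_mult[symmetric] m_ac)
    ultimately show "y \<otimes> z \<in> H'" using H'I Hc by metis
  qed
  have "h \<in> H'" if "h \<in> H" for h using H'I[OF that, of 0] that HG by simp
  moreover have "x \<in> H'" using H'I[OF Hc(1), of 1] x by simp
  ultimately have psub: "H \<subset> H'" using x by blast
  have extend: "\<exists>\<chi>'. character_on H' \<chi>' \<and> (\<forall>h\<in>H. \<forall>i. \<chi>' (h \<otimes> x [^] i) = \<chi> h * \<zeta> ^ i)"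
    if \<chi>: "character_on H \<chi>" and \<zeta>: "\<zeta> ^ n = \<chi> (x [^] n)" for \<chi> \<zeta>
  proof -
    have wd: "\<chi> h * \<zeta> ^ i = \<chi> k * \<zeta> ^ j"
      if hk: "h \<in> H" "k \<in> H" "h \<otimes> x [^] i = k \<otimes> x [^] j" "i \<le> j" for h k and i j :: nat
    proof -
      obtain q where q: "j = i + n * q" "h = k \<otimes> (x [^] n) [^] q" using cancel[OF hk] by blast
      have "\<chi> h = \<chi> k * (\<zeta> ^ n) ^ q"
        using q(2) \<chi> \<zeta> hk n Hpow character_on_power[OF H \<chi> n(2), of q] by (simp add: character_on_def)
      then show ?thesis by (simp add: q(1) power_add power_mult)
    qed
    define \<chi>' where "\<chi>' y = (let (h, i) = SOME (h, i). h \<in> H \<and> y = h \<otimes> x [^] (i :: nat) in \<chi> h * \<zeta> ^ i)" for y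
    have \<chi>': "\<chi>' (h \<otimes> x [^] i) = \<chi> h * \<zeta> ^ i" if h: "h \<in> H" for h and i :: nat
    proof -
      obtain k j where kj: "(SOME (k, j). k \<in> H \<and> h \<otimes> x [^] i = k \<otimes> x [^] (j :: nat)) = (k, j)" by fastforce
      have "case (k, j) of (k, j) \<Rightarrow> k \<in> H \<and> h \<otimes> x [^] i = k \<otimes> x [^] j"
        unfolding kj[symmetric] by (rule someI[of _ "(h, i)"]) (use h in simp)
      then have "\<chi> h * \<zeta> ^ i = \<chi> k * \<zeta> ^ j"
        using wd[of h k i j] wd[of k h j i] h by (cases "i \<le> j") auto
      then show ?thesis by (simp add: \<chi>'_def kj)
    qed
    have "character_on H' \<chi>'"
      unfolding character_on_def
    proof (intro conjI ballI)
      show "\<chi>' \<one> = 1" using \<chi>'[OF Hc(1), of 0] \<chi> by (simp add: character_on_def)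
      fix y z assume "y \<in> H'" "z \<in> H'"
      then obtain h k and i j :: nat where hk: "h \<in> H" "k \<in> H" "y = h \<otimes> x [^] i" "z = k \<otimes> x [^] j"
        using H'E by metis
      then have "y \<otimes> z = (h \<otimes> k) \<otimes> x [^] (i + j)"
        using HG x by (simp add: nat_pow_mult[symmetric] m_ac)
      then show "\<chi>' (y \<otimes> z) = \<chi>' y * \<chi>' z"
        using hk \<chi> Hc by (simp add: \<chi>' character_on_def power_add)
    qed
    then show ?thesis using \<chi>' by blast
  qed
  have "separated_by_characters H'"
    unfolding separated_by_characters_def
  proof (intro allI impI ballI)
    fix f :: "'a \<Rightarrow> complex" and y
    assume f: "\<forall>\<chi>. character_on H' \<chi> \<longrightarrow> (\<Sum>x\<in>H'. f x * \<chi> x) = 0" and "y \<in> H'"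
    then obtain h i where y: "h \<in> H" "i < n" "y = h \<otimes> x [^] i" using H'E by blast
    have "(\<Sum>h\<in>H. f (h \<otimes> x [^] i) * \<chi> h) = 0" if \<chi>: "character_on H \<chi>" for \<chi>
    proof -
      define a where "a i = (\<Sum>h\<in>H. f (h \<otimes> x [^] i) * \<chi> h)" for i :: nat
      define P where "P = (\<Sum>i<n. Polynomial.monom (a i) i)"
      let ?c = "\<chi> (x [^] n)"
      have "\<chi> (inv (x [^] n) \<otimes> x [^] n) = \<chi> (inv (x [^] n)) * ?c"
        using \<chi> n Hc by (simp add: character_on_def)
      then have "?c \<noteq> 0" using \<chi> x by (auto simp: character_on_def)
      have root: "poly P \<zeta> = 0" if \<zeta>: "\<zeta> ^ n = ?c" for \<zeta>
      proof -
        obtain \<chi>' where \<chi>': "character_on H' \<chi>'" "\<And>h i. h \<in> H \<Longrightarrow> \<chi>' (h \<otimes> x [^] i) = \<chi> h * \<zeta> ^ i"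
          using extend[OF \<chi> \<zeta>] by blast
        have "0 = (\<Sum>x\<in>H'. f x * \<chi>' x)" using f \<chi>' by simp
        also have "\<dots> = (\<Sum>(h, i)\<in>H \<times> {..<n}. f (h \<otimes> x [^] i) * (\<chi> h * \<zeta> ^ i))"
          unfolding H'_def by (subst sum.reindex[OF inj]) (auto intro!: sum.cong simp: \<chi>')
        also have "\<dots> = (\<Sum>i<n. a i * \<zeta> ^ i)"
          unfolding a_def sum_distrib_right
          by (subst sum.swap) (simp add: sum.cartesian_product mult.assoc)
        also have "\<dots> = poly P \<zeta>" by (simp add: P_def poly_sum poly_monom)
        finally show ?thesis by simp
      qed
      have "P = 0"
      proof (rule ccontr)
        assume P: "P \<noteq> 0"
        have "{\<zeta>. \<zeta> ^ n = ?c} \<subseteq> {\<zeta>. poly P \<zeta> = 0}" using root by blast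
        then have "n \<le> card {\<zeta>. poly P \<zeta> = 0}"
          using card_mono[OF poly_roots_finite[OF P]] card_nth_roots[OF \<open>?c \<noteq> 0\<close> n(1)] by metis
        also have "\<dots> \<le> Polynomial.degree P" using P by (rule card_poly_roots_bound)
        also have "\<dots> < n"
          unfolding P_def using n(1)
          by (intro degree_sum_less) (auto intro: le_less_trans[OF degree_monom_le])
        finally show False by simp
      qed
      then have "Polynomial.coeff P i = 0" by simp
      then have "a i = 0" using y(2) by (simp add: P_def coeff_sum)
      then show ?thesis by (simp add: a_def)
    qed
    then have "\<forall>h\<in>H. f (h \<otimes> x [^] i) = 0"
      using sep[unfolded separated_by_characters_def, THEN spec, of "\<lambda>h. f (h \<otimes> x [^] i)"] by simp
    then show "f y = 0" using y by simp
  qed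
  then show ?thesis using H' psub by blast
qed

text \<open>A largest subgroup that is separated by its characters cannot be extended, so it is the whole group.\<close>

theorem separated_by_characters_carrier:
  assumes fin: "finite (carrier G)"
  shows "separated_by_characters (carrier G)"
proof -
  define Q where "Q H \<longleftrightarrow> subgroup H G \<and> separated_by_characters H" for H
  have "Q {\<one>}"
  proof -
    have "separated_by_characters {\<one>}"
      unfolding separated_by_characters_def
    proof (intro allI impI ballI)
      fix f :: "'a \<Rightarrow> complex" and x
      assume "\<forall>\<chi>. character_on {\<one>} \<chi> \<longrightarrow> (\<Sum>x\<in>{\<one>}. f x * \<chi> x) = 0" "x \<in> {\<one>}"
      then show "f x = 0" by (auto dest!: spec[of _ "\<lambda>_. 1"] simp: character_on_def)
    qed
    then show ?thesis using triv_subgroup by (simp add: Q_def)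
  qed
  moreover have "card H \<le> Coset.order G" if "Q H" for H
    using that card_mono[OF fin subgroup.subset] by (simp add: Q_def Coset.order_def)
  ultimately obtain H where H: "Q H" "\<And>K. Q K \<Longrightarrow> card K \<le> card H"
    using ex_has_greatest_nat[of Q "{\<one>}" card "Suc (Coset.order G)"] by (metis less_Suc_eq_le)
  have "H = carrier G"
  proof (rule ccontr)
    assume "H \<noteq> carrier G"
    moreover have sub: "subgroup H G" "separated_by_characters H" using H(1) by (auto simp: Q_def)
    ultimately obtain x where "x \<in> carrier G" "x \<notin> H" using subgroup.subset by blast
    then obtain K where K: "subgroup K G" "H \<subset> K" "separated_by_characters K"
      using separated_by_characters_extend[OF fin sub(1) _ _ sub(2)] by blast
    then have "card H < card K"
      using fin subgroup.subset[OF K(1)] by (metis psubset_card_mono finite_subset)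
    then show False using H(2)[of K] K by (simp add: Q_def)
  qed
  then show ?thesis using H(1) by (simp add: Q_def)
qed

lemma ZG_eq_0_if_characters_vanish:
  assumes "finite (carrier G)" "a \<in> carrier ZG"
    and "\<And>\<chi>. character_on (carrier G) \<chi> \<Longrightarrow> linear_extension \<chi> a = 0"
  shows "a = 0"
proof (rule poly_mapping_eqI)
  fix g
  have "(\<Sum>x\<in>carrier G. of_int (Poly_Mapping.lookup a x) * \<chi> x) = 0"
    if "character_on (carrier G) \<chi>" for \<chi>
    using assms(3)[OF that] linear_extension_superset[OF assms(1), of a \<chi>] assms(2) by (simp add: mem_ZG_iff)
  then have "\<forall>x\<in>carrier G. of_int (Poly_Mapping.lookup a x) = (0 :: complex)"
    using separated_by_characters_carrier[OF assms(1)] unfolding separated_by_characters_def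
    by (elim allE[of _ "\<lambda>x. of_int (Poly_Mapping.lookup a x)"]) blast
  then show "Poly_Mapping.lookup a g = Poly_Mapping.lookup 0 g"
    using assms(2) by (cases "g \<in> carrier G") (auto simp: mem_ZG_iff in_keys_iff)
qed

end

section \<open>Eisenstein integers\<close>

definition eisenstein_omega :: complex (\<open>\<omega>\<close>) where
  "\<omega> = Complex (- 1 / 2) (sqrt 3 / 2)"

definition eisenstein :: "complex set" where
  "eisenstein = {of_int a + of_int b * \<omega> | a b. True}"

lemma omega_square: "\<omega> * \<omega> = - 1 - \<omega>"
  by (simp add: eisenstein_omega_def complex_eq_iff)

lemma eisenstein_add: "z \<in> eisenstein \<Longrightarrow> w \<in> eisenstein \<Longrightarrow> z + w \<in> eisenstein"
proof -
  assume "z \<in> eisenstein" "w \<in> eisenstein"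
  then obtain a b c d where "z = of_int a + of_int b * \<omega>" "w = of_int c + of_int d * \<omega>"
    by (auto simp: eisenstein_def)
  then have "z + w = of_int (a + c) + of_int (b + d) * \<omega>" by (simp add: algebra_simps)
  then show ?thesis unfolding eisenstein_def by blast
qed

lemma eisenstein_mult: "z \<in> eisenstein \<Longrightarrow> w \<in> eisenstein \<Longrightarrow> z * w \<in> eisenstein"
proof -
  assume "z \<in> eisenstein" "w \<in> eisenstein"
  then obtain a b c d where *: "z = of_int a + of_int b * \<omega>" "w = of_int c + of_int d * \<omega>"
    by (auto simp: eisenstein_def)
  have "z * w = of_int a * of_int c + (of_int a * of_int d + of_int b * of_int c) * \<omega> + of_int b * of_int d * (\<omega> * \<omega>)"
    unfolding * by (simp add: algebra_simps)
  also have "\<dots> = of_int (a * c - b * d) + of_int (a * d + b * c - b * d) * \<omega>"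
    unfolding omega_square by (simp add: algebra_simps)
  finally show ?thesis unfolding eisenstein_def by blast
qed

lemma eisenstein_of_int [simp]: "of_int k \<in> eisenstein"
  unfolding eisenstein_def by (rule CollectI, rule exI[of _ k], rule exI[of _ 0]) simp

lemma eisenstein_numerals [simp]: "0 \<in> eisenstein" "1 \<in> eisenstein"
  using eisenstein_of_int[of 0] eisenstein_of_int[of 1] by simp_all

lemma eisenstein_omega [simp]: "\<omega> \<in> eisenstein"
  unfolding eisenstein_def by (rule CollectI, rule exI[of _ 0], rule exI[of _ 1]) simp

lemma eisenstein_minus: "z \<in> eisenstein \<Longrightarrow> - z \<in> eisenstein"
  using eisenstein_mult[of "of_int (-1)" z] eisenstein_of_int[of "-1"] by simp

lemma eisenstein_diff: "z \<in> eisenstein \<Longrightarrow> w \<in> eisenstein \<Longrightarrow> z - w \<in> eisenstein"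
  using eisenstein_add[of z "- w"] eisenstein_minus by simp

text \<open>The norm \<open>a\<^sup>2 - ab + b\<^sup>2\<close> is an integer. Nonzero Eisenstein integers therefore have absolute
  value at least one, and divisibility passes to norms.\<close>

lemma eisenstein_norm:
  assumes "z \<in> eisenstein"
  obtains k :: nat where "(cmod z)\<^sup>2 = real k"
proof -
  obtain a b where z: "z = of_int a + of_int b * \<omega>" using assms by (auto simp: eisenstein_def)
  have "(cmod z)\<^sup>2 = (a - b / 2)\<^sup>2 + (b * (sqrt 3 / 2))\<^sup>2"
    by (simp add: z cmod_power2 eisenstein_omega_def)
  also have "\<dots> = of_int (a\<^sup>2 - a * b + b\<^sup>2)"
    by (simp add: power_mult_distrib power_divide) (simp add: power2_eq_square algebra_simps)
  finally have *: "(cmod z)\<^sup>2 = of_int (a\<^sup>2 - a * b + b\<^sup>2)" .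
  then have "a\<^sup>2 - a * b + b\<^sup>2 \<ge> 0" by (metis of_int_0_le_iff zero_le_power2)
  then show ?thesis using * that[of "nat (a\<^sup>2 - a * b + b\<^sup>2)"] by simp
qed

lemma cube_root_of_unity_cases:
  fixes z :: complex
  assumes "z ^ 3 = 1"
  shows "z = 1 \<or> z = \<omega> \<or> z = \<omega> * \<omega>"
proof -
  have "(z - 1) * ((z - \<omega>) * (z - \<omega> * \<omega>)) = (z - 1) * (z * z - z * (\<omega> + \<omega> * \<omega>) + \<omega> * (\<omega> * \<omega>))"
    by (simp add: algebra_simps)
  also have "\<omega> * (\<omega> * \<omega>) = 1"
    unfolding omega_square by (simp add: algebra_simps omega_square)
  also have "\<omega> + \<omega> * \<omega> = - 1" unfolding omega_square by simp
  also have "(z - 1) * (z * z - z * (- 1) + 1) = z ^ 3 - 1" by (simp add: algebra_simps power3_eq_cube)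
  finally show ?thesis using assms by auto
qed

lemma norm_one_minus_omega: "(cmod (1 - \<omega>))\<^sup>2 = 3"
  by (simp add: cmod_power2 eisenstein_omega_def power_divide)

text \<open>A nonzero multiple of \<open>\<pi>\<^sup>n\<close> has norm at least \<open>2\<^sup>n\<close>.\<close>

lemma eisenstein_zero_if_divisible_by_all_powers:
  assumes e: "\<And>n. \<exists>e\<in>eisenstein. z = \<pi> ^ n * e" and \<pi>: "(cmod \<pi>)\<^sup>2 \<ge> 2"
  shows "z = 0"
proof (rule ccontr)
  assume z: "z \<noteq> 0"
  have "2 ^ n \<le> (cmod z)\<^sup>2" for n :: nat
  proof -
    obtain e where e: "e \<in> eisenstein" "z = \<pi> ^ n * e" using e by blast
    obtain k :: nat where k: "(cmod e)\<^sup>2 = real k" using e(1) by (rule eisenstein_norm)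
    have "(cmod e)\<^sup>2 \<noteq> 0" using e z by auto
    then have "k \<noteq> 0" using k by auto
    have "(cmod z)\<^sup>2 = ((cmod \<pi>)\<^sup>2) ^ n * real k"
      by (simp add: e(2) norm_mult norm_power power_mult_distrib k mult.commute flip: power_mult)
    also have "\<dots> \<ge> 2 ^ n * 1"
      using \<pi> \<open>k \<noteq> 0\<close> by (intro mult_mono power_mono) auto
    finally show ?thesis by simp
  qed
  moreover obtain n where "(cmod z)\<^sup>2 < 2 ^ n" using real_arch_pow[of 2] by auto
  ultimately show False by (metis not_less)
qed

section \<open>The residue of an abelian group of exponent six\<close>

context group
begin

lemma linear_extension_mult:
  assumes \<chi>: "character_on (carrier G) \<chi>" and a: "a \<in> carrier ZG" and b: "b \<in> carrier ZG"
  shows "linear_extension \<chi> (a \<star> b) = linear_extension \<chi> a * linear_extension \<chi> b"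
  using a
proof (induction a rule: ZG_induct)
  case (of g)
  show ?case using b
    by (induction b rule: ZG_induct)
       (use \<chi> of in \<open>auto simp: character_on_def mult_distribs linear_extension_diff algebra_simps\<close>)
qed (auto simp: mult_distribs linear_extension_diff algebra_simps)

text \<open>Congruences between characters carry over from group elements to the group ring.\<close>

lemma linear_extension_divisible:
  assumes "\<And>g. g \<in> carrier G \<Longrightarrow> \<exists>e\<in>eisenstein. \<phi> g - \<psi> g = \<pi> * e" and "a \<in> carrier ZG"
  shows "\<exists>e\<in>eisenstein. linear_extension \<phi> a - linear_extension \<psi> a = \<pi> * e"
  using assms(2)
proof (induction a rule: ZG_induct)
  case (diff a b)
  then obtain e f where "e \<in> eisenstein" "f \<in> eisenstein"
    "linear_extension \<phi> a - linear_extension \<psi> a = \<pi> * e" "linear_extension \<phi> b - linear_extension \<psi> b = \<pi> * f"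
    by blast
  then show ?case
    by (intro bexI[of _ "e - f"]) (auto simp: linear_extension_diff eisenstein_diff algebra_simps)
qed (use assms(1) in \<open>auto intro: bexI[of _ 0]\<close>)

lemma linear_extension_mem_eisenstein:
  assumes "\<And>g. g \<in> carrier G \<Longrightarrow> \<phi> g \<in> eisenstein" "a \<in> carrier ZG"
  shows "linear_extension \<phi> a \<in> eisenstein"
  using assms(2) by (induction a rule: ZG_induct) (auto simp: assms(1) linear_extension_diff eisenstein_diff)

lemma linear_extension_\<Delta>:
  assumes \<chi>: "character_on (carrier G) \<chi>"
    and E: "\<And>g. g \<in> carrier G \<Longrightarrow> \<chi> g \<in> eisenstein"
    and \<pi>: "\<And>g. g \<in> carrier G \<Longrightarrow> \<exists>e\<in>eisenstein. \<chi> g - 1 = \<pi> * e"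
  shows "a \<in> \<Delta> n \<Longrightarrow> \<exists>e\<in>eisenstein. linear_extension \<chi> a = \<pi> ^ n * e"
proof (induction n arbitrary: a)
  case 0
  then show ?case using linear_extension_mem_eisenstein[of \<chi> a] E by auto
next
  case (Suc n)
  from Suc.prems show ?case
  proof (induction rule: \<Delta>_Suc_induct)
    case (mult x y)
    then have y: "y \<in> carrier ZG" "augmentation y = 0" by (auto simp: augmentation_ideal_iff)
    have "linear_extension (\<lambda>_. 1) y = of_int (augmentation y)"
      by (simp add: linear_extension_def augmentation_def)
    moreover obtain f where f: "f \<in> eisenstein" "linear_extension \<chi> y - linear_extension (\<lambda>_. 1) y = \<pi> * f"
      using linear_extension_divisible[of \<chi> "\<lambda>_. 1" \<pi> y] \<pi> y by blast
    moreover obtain e where e: "e \<in> eisenstein" "linear_extension \<chi> x = \<pi> ^ n * e" using Suc.IH mult by blast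
    moreover have "linear_extension \<chi> (x \<star> y) = linear_extension \<chi> x * linear_extension \<chi> y"
      using linear_extension_mult[OF \<chi> \<Delta>_carrier[OF mult(1)] y(1)] .
    ultimately show ?case using y by (intro bexI[of _ "e * f"]) (auto simp: eisenstein_mult)
  next
    case (add x y)
    then obtain e f where "e \<in> eisenstein" "f \<in> eisenstein"
      "linear_extension \<chi> x = \<pi> ^ Suc n * e" "linear_extension \<chi> y = \<pi> ^ Suc n * f" by blast
    then show ?case
      by (intro bexI[of _ "e + f"]) (simp_all add: linear_extension_add eisenstein_add algebra_simps)
  qed
qed

text \<open>The character maps the augmentation ideal into the multiples of \<open>\<pi>\<close>, hence \<open>u - 1\<close> to an
  Eisenstein integer divisible by all powers of \<open>\<pi>\<close>. Characters of order two and three satisfy this with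
  \<open>\<pi> = 2\<close> and \<open>\<pi> = 1 - \<omega>\<close>; those of order six do not, as \<open>1 + \<omega>\<close> is a unit.\<close>

lemma linear_extension_residue:
  assumes \<chi>: "character_on (carrier G) \<chi>"
    and E: "\<And>g. g \<in> carrier G \<Longrightarrow> \<chi> g \<in> eisenstein"
    and \<pi>: "\<And>g. g \<in> carrier G \<Longrightarrow> \<exists>e\<in>eisenstein. \<chi> g - 1 = \<pi> * e" "(cmod \<pi>)\<^sup>2 \<ge> 2"
    and u: "u \<in> delta_adic_residue G"
  shows "linear_extension \<chi> u = 1"
proof -
  have "\<exists>e\<in>eisenstein. linear_extension \<chi> (u - frag_of \<one>) = \<pi> ^ n * e" for n
    using u by (intro linear_extension_\<Delta>[OF \<chi> E \<pi>(1)]) (auto simp: delta_adic_residue_iff)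
  then have "linear_extension \<chi> (u - frag_of \<one>) = 0"
    using \<pi>(2) by (rule eisenstein_zero_if_divisible_by_all_powers)
  then show ?thesis using \<chi> by (simp add: linear_extension_diff character_on_def)
qed

end

text \<open>Write a character as \<open>\<chi> = \<alpha>\<beta>\<close> with \<open>\<alpha> = \<chi>\<^sup>3\<close> quadratic and \<open>\<beta> = \<chi>\<^sup>4\<close> cubic. For \<open>u\<close> in the residue,
  \<open>\<alpha>(u) = \<beta>(u) = 1\<close>. As \<open>\<chi> \<equiv> \<beta>\<close> modulo \<open>2\<close> and \<open>\<chi> \<equiv> \<alpha>\<close> modulo \<open>1 - \<omega>\<close>, the number \<open>\<chi>(u) - 1\<close> is
  divisible by \<open>2\<close> and by \<open>1 - \<omega>\<close>; if nonzero, its squared absolute value is divisible by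
  \<open>4\<close> and by \<open>3\<close>, so it is at least \<open>12\<close>. But \<open>u\<close> is a unit, so \<open>\<chi>(u)\<close> has absolute value \<open>1\<close> and lies at
  distance at most \<open>2\<close> from \<open>1\<close>. Hence \<open>\<chi>(u) = 1\<close> for all \<open>\<chi>\<close>.\<close>

lemma (in comm_group) exponent_6_residue_trivial:
  assumes fin: "finite (carrier G)" and six: "\<And>x. x \<in> carrier G \<Longrightarrow> x [^] (6 :: nat) = \<one>"
  shows "delta_adic_residue G = {frag_of \<one>}"
proof -
  have "u = frag_of \<one>" if u: "u \<in> delta_adic_residue G" for u
  proof -
    have "u \<in> Units ZG" using u by (simp add: delta_adic_residue_iff)
    then obtain v where uv: "u \<in> carrier ZG" "v \<in> carrier ZG" "u \<star> v = frag_of \<one>"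
      by (auto simp: Units_def)
    have "linear_extension \<chi> u = 1" if \<chi>: "character_on (carrier G) \<chi>" for \<chi>
    proof -
      let ?L = "linear_extension \<chi>"
      define \<alpha> where "\<alpha> g = \<chi> g ^ 3" for g
      define \<beta> where "\<beta> g = \<chi> g ^ 4" for g
      have \<chi>6: "\<chi> g ^ 6 = 1" if "g \<in> carrier G" for g
        using character_on_power[OF subgroup_self \<chi> that, of 6] six[OF that] \<chi>
        by (simp add: character_on_def)
      have \<alpha>c: "character_on (carrier G) \<alpha>" and \<beta>c: "character_on (carrier G) \<beta>"
        using \<chi> by (auto simp: character_on_def \<alpha>_def \<beta>_def power_mult_distrib)
      have \<alpha>: "\<exists>e\<in>eisenstein. \<alpha> g - 1 = 2 * e" if g: "g \<in> carrier G" for g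
      proof -
        have "\<alpha> g ^ 2 = 1" using \<chi>6[OF g] by (simp add: \<alpha>_def flip: power_mult)
        then have "\<alpha> g = 1 \<or> \<alpha> g = - 1" by (simp add: power2_eq_1_iff)
        then show ?thesis using eisenstein_of_int[of "-1"] by (auto intro: bexI[of _ 0] bexI[of _ "-1"])
      qed
      have \<beta>_cases: "\<beta> g = 1 \<or> \<beta> g = \<omega> \<or> \<beta> g = \<omega> * \<omega>" if g: "g \<in> carrier G" for g
      proof -
        have "\<beta> g ^ 3 = (\<chi> g ^ 6) ^ 2" by (simp add: \<beta>_def flip: power_mult)
        then show ?thesis using \<chi>6[OF g] by (intro cube_root_of_unity_cases) simp
      qed
      have \<beta>: "\<exists>e\<in>eisenstein. \<beta> g - 1 = (1 - \<omega>) * e" if g: "g \<in> carrier G" for g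
        using \<beta>_cases[OF g]
      proof (elim disjE)
        assume "\<beta> g = \<omega>"
        then show ?thesis using eisenstein_of_int[of "-1"] by (intro bexI[of _ "-1"]) auto
      next
        assume "\<beta> g = \<omega> * \<omega>"
        moreover have "- (1 + \<omega>) \<in> eisenstein" by (intro eisenstein_minus eisenstein_add) simp_all
        ultimately show ?thesis by (intro bexI[of _ "- (1 + \<omega>)"]) (auto simp: algebra_simps)
      qed (auto intro: bexI[of _ 0])
      have \<alpha>E: "\<alpha> g \<in> eisenstein" if g: "g \<in> carrier G" for g
      proof -
        obtain e where "e \<in> eisenstein" "\<alpha> g - 1 = 2 * e" using \<alpha>[OF g] by blast
        then have "\<alpha> g = e + e + 1" by (simp add: algebra_simps)
        moreover have "e + e + 1 \<in> eisenstein"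
          using \<open>e \<in> eisenstein\<close> by (intro eisenstein_add) simp_all
        ultimately show ?thesis by (simp only:)
      qed
      have \<beta>E: "\<beta> g \<in> eisenstein" if g: "g \<in> carrier G" for g
        using \<beta>_cases[OF g] eisenstein_mult[OF eisenstein_omega eisenstein_omega] by auto
      have \<chi>_prod: "\<chi> g = \<alpha> g * \<beta> g" if g: "g \<in> carrier G" for g
        using \<chi>6[OF g] by (simp add: \<alpha>_def \<beta>_def numeral_eq_Suc) 
      have \<chi>E: "\<chi> g \<in> eisenstein" if g: "g \<in> carrier G" for g
        using \<chi>_prod[OF g] \<alpha>E[OF g] \<beta>E[OF g] by (simp add: eisenstein_mult)
      have \<alpha>u: "linear_extension \<alpha> u = 1"
        by (rule linear_extension_residue[OF \<alpha>c \<alpha>E \<alpha> _ u]) simp_all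
      have \<beta>u: "linear_extension \<beta> u = 1"
        by (rule linear_extension_residue[OF \<beta>c \<beta>E \<beta> _ u]) (simp_all add: norm_one_minus_omega)
      have "\<exists>e\<in>eisenstein. \<chi> g - \<beta> g = 2 * e" if g: "g \<in> carrier G" for g
      proof -
        obtain e where "e \<in> eisenstein" "\<alpha> g - 1 = 2 * e" using \<alpha>[OF g] by blast
        moreover have "\<chi> g - \<beta> g = \<beta> g * (\<alpha> g - 1)" using \<chi>_prod[OF g] by (simp add: algebra_simps)
        ultimately show ?thesis using \<beta>E[OF g] by (intro bexI[of _ "\<beta> g * e"]) (auto intro: eisenstein_mult)
      qed
      then obtain z where z: "z \<in> eisenstein" "?L u - 1 = 2 * z"
        using linear_extension_divisible[of \<chi> \<beta> 2 u] uv(1) \<beta>u by auto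
      have "\<exists>e\<in>eisenstein. \<chi> g - \<alpha> g = (1 - \<omega>) * e" if g: "g \<in> carrier G" for g
      proof -
        obtain e where "e \<in> eisenstein" "\<beta> g - 1 = (1 - \<omega>) * e" using \<beta>[OF g] by blast
        moreover have "\<chi> g - \<alpha> g = \<alpha> g * (\<beta> g - 1)" using \<chi>_prod[OF g] by (simp add: algebra_simps)
        ultimately show ?thesis using \<alpha>E[OF g] by (intro bexI[of _ "\<alpha> g * e"]) (auto intro: eisenstein_mult)
      qed
      then obtain w where w: "w \<in> eisenstein" "?L u - 1 = (1 - \<omega>) * w"
        using linear_extension_divisible[of \<chi> \<alpha> "1 - \<omega>" u] uv(1) \<alpha>u by auto
      have "cmod (?L u) = 1"
      proof -
        have "?L u * ?L v = 1"
          using linear_extension_mult[OF \<chi> uv(1,2)] uv(3) \<chi> by (simp add: character_on_def)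
        then have "(cmod (?L u))\<^sup>2 * (cmod (?L v))\<^sup>2 = 1" by (metis norm_mult norm_one power_mult_distrib power_one)
        moreover obtain i where i: "(cmod (?L u))\<^sup>2 = real i"
          using eisenstein_norm linear_extension_mem_eisenstein[of \<chi> u] \<chi>E uv(1) by metis
        moreover obtain j where "(cmod (?L v))\<^sup>2 = real j"
          using eisenstein_norm linear_extension_mem_eisenstein[of \<chi> v] \<chi>E uv(2) by metis
        ultimately have "i * j = 1" by (metis of_nat_eq_1_iff of_nat_mult)
        then show ?thesis using i by (simp add: power2_eq_1_iff) (metis norm_ge_zero not_one_le_zero neg_0_le_iff_le)
      qed
      then have "cmod (2 * z) \<le> 2"
        using norm_triangle_ineq4[of "?L u" 1] z(2) by simp
      then have "(cmod z)\<^sup>2 \<le> 1" by (simp add: norm_mult power_le_one)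
      moreover obtain k where k: "(cmod z)\<^sup>2 = real k" using eisenstein_norm z by metis
      ultimately have "k \<le> 1" by simp
      obtain l where l: "(cmod w)\<^sup>2 = real l" using eisenstein_norm w by metis
      have "(cmod (2 * z))\<^sup>2 = (cmod ((1 - \<omega>) * w))\<^sup>2" using z w by simp
      then have "4 * real k = 3 * real l"
        by (simp add: norm_mult power_mult_distrib k l norm_one_minus_omega)
      then have "4 * k = 3 * l" by linarith
      then have "k = 0" using \<open>k \<le> 1\<close> by presburger
      then show "?L u = 1" using k z by simp
    qed
    then have "u - frag_of \<one> = 0"
      using uv(1) by (intro ZG_eq_0_if_characters_vanish fin) (auto simp: linear_extension_diff character_on_def)
    then show ?thesis by simp
  qed
  then show ?thesis using one_mem_residue by blast
qed

section \<open>The classification\<close>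

context group
begin

lemma ord_pos: "finite (carrier G) \<Longrightarrow> g \<in> carrier G \<Longrightarrow> 0 < ord g"
  using ord_ge_1 by force

lemma exists_element_of_order:
  assumes fin: "finite (carrier G)" and g: "g \<in> carrier G" and d: "d dvd ord g"
  obtains h where "h \<in> carrier G" "ord h = d"
proof -
  have "0 < ord g" using ord_pos[OF fin g] .
  moreover obtain k where k: "ord g = d * k" using d by blast
  ultimately have "ord (g [^] k) = d" using ord_pow[OF g, of k] by simp
  then show ?thesis using that[of "g [^] k"] g by simp
qed

text \<open>Elements of coprime order commute, so their product has order \<open>ord a * ord b\<close>, and the units of
  cyclic group rings apply to it.\<close>

lemma coprime_order_product_eq_6:
  assumes fin: "finite (carrier G)" and res: "delta_adic_residue G = {frag_of \<one>}"
    and a: "a \<in> carrier G" "a \<noteq> \<one>" and b: "b \<in> carrier G" "b \<noteq> \<one>"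
    and cop: "coprime (ord a) (ord b)"
  shows "ord a * ord b = 6"
proof (rule ccontr)
  assume "ord a * ord b \<noteq> 6"
  have comm: "a \<otimes> b = b \<otimes> a"
    using coprime_torsion_commute[OF res a(1) pow_ord_eq_1[OF a(1)] b(1) pow_ord_eq_1[OF b(1)] cop] .
  have pow: "(a \<otimes> b) [^] n = a [^] n \<otimes> b [^] n" for n :: nat
    using pow_mult_distrib[OF comm a(1) b(1)] .
  let ?n = "ord (a \<otimes> b)"
  have one: "a [^] ?n \<otimes> b [^] ?n = \<one>" using pow[of ?n] a b by simp
  have "ord a dvd ?n"
  proof -
    have "a [^] (?n * ord b) = (a \<otimes> b) [^] (?n * ord b)"
      using a b by (simp add: pow nat_pow_pow[symmetric] mult.commute[of ?n])
    also have "\<dots> = \<one>" using a b by (simp add: nat_pow_pow[symmetric])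
    finally have "ord a dvd ?n * ord b" using a pow_eq_id by simp
    then show ?thesis using cop by (simp add: coprime_dvd_mult_left_iff)
  qed
  moreover have "ord b dvd ?n"
  proof -
    have "b [^] (?n * ord a) = (a \<otimes> b) [^] (?n * ord a)"
      using a b by (simp add: pow nat_pow_pow[symmetric] mult.commute[of ?n])
    also have "\<dots> = \<one>" using a b by (simp add: nat_pow_pow[symmetric])
    finally have "ord b dvd ?n * ord a" using b pow_eq_id by simp
    then show ?thesis using cop by (simp add: coprime_dvd_mult_left_iff coprime_commute)
  qed
  ultimately have "ord a * ord b dvd ?n" using cop by (simp add: divides_mult)
  moreover have "?n dvd ord a * ord b" using ord_mul_divides[OF comm a(1) b(1)] .
  ultimately have "?n = ord a * ord b" by (rule dvd_antisym[rotated])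
  moreover have "ord g \<ge> 2" if "g \<in> carrier G" "g \<noteq> \<one>" for g
    using ord_pos[OF fin that(1)] ord_eq_1[OF that(1)] that(2) by linarith
  ultimately show False
    using nontrivial_residue_of_cyclic[of "a \<otimes> b" "ord a" "ord b"] a b cop res \<open>ord a * ord b \<noteq> 6\<close> by auto
qed

lemma not_p_group_element_of_prime_order:
  assumes fin: "finite (carrier G)" and p: "Factorial_Ring.prime p" "\<not> p_group p G"
  obtains q b where "Factorial_Ring.prime q" "q \<noteq> p" "b \<in> carrier G" "ord b = q"
proof -
  obtain x where x: "x \<in> carrier G" "\<And>k. ord x \<noteq> p ^ k" using p is_group by (auto simp: p_group_def)
  have "ord x \<noteq> 0" using ord_pos[OF fin x(1)] by simp
  then obtain m where m: "ord x = p ^ multiplicity p (ord x) * m" "\<not> p dvd m"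
    using multiplicity_decompose'[of "ord x" p] p(1) by (metis not_prime_unit)
  have "m \<noteq> 1" using m(1) x(2) by (metis mult.right_neutral)
  then obtain q where q: "Factorial_Ring.prime q" "q dvd m" using prime_factor_nat by blast
  then have "q dvd ord x" using m(1) by (metis dvd_mult)
  then obtain b where "b \<in> carrier G" "ord b = q" using exists_element_of_order[OF fin x(1)] by metis
  then show ?thesis using that q m(2) by blast
qed

text \<open>There are elements \<open>a\<close> of order \<open>2\<close> and \<open>b\<close> of order \<open>3\<close>, these being the only distinct primes with
  product \<open>6\<close>. An element of order a power of \<open>2\<close> is compared with \<open>b\<close>, an element of order a power of another
  prime with \<open>a\<close>; this leaves only the orders dividing \<open>6\<close>. Finally, \<open>b\<close> serves as the third element \<open>z\<close> when
  two elements of order \<open>2\<close> are shown to commute, and \<open>a\<close> does so for elements of order \<open>3\<close>.\<close>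

lemma residue_trivial_imp_exponent_6:
  assumes fin: "finite (carrier G)" and res: "delta_adic_residue G = {frag_of \<one>}"
    and not_p: "\<And>p. Factorial_Ring.prime p \<Longrightarrow> \<not> p_group p G"
  shows "comm_group G \<and> group_exponent G = 6"
proof -
  obtain q b where q: "Factorial_Ring.prime q" "q \<noteq> 2" and b: "b \<in> carrier G" "ord b = q"
    using not_p_group_element_of_prime_order[OF fin two_is_prime_nat not_p[OF two_is_prime_nat]] by metis
  obtain r a where r: "Factorial_Ring.prime r" "r \<noteq> q" and a: "a \<in> carrier G" "ord a = r"
    using not_p_group_element_of_prime_order[OF fin q(1) not_p[OF q(1)]] by metis
  have ne: "g \<noteq> \<one>" if "ord g \<noteq> 1" for g using that by auto
  have "r * q = 6"
    using coprime_order_product_eq_6[OF fin res a(1) ne b(1) ne] a b r q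
    by (metis not_prime_1 primes_coprime)
  have "q dvd 6" using \<open>r * q = 6\<close> by (metis dvd_triv_right)
  then have "q \<le> 6" by (rule dvd_imp_le) simp
  moreover have "2 < q" "r \<noteq> 1" using q r prime_gt_1_nat[of q] by auto
  ultimately have "q \<in> {3, 4, 5, 6}" by auto
  then have "q = 3" using \<open>r * q = 6\<close> \<open>r \<noteq> 1\<close> by (elim insertE) auto
  then have "r = 2" using \<open>r * q = 6\<close> by simp
  note a = a(1) a(2)[unfolded \<open>r = 2\<close>] and b = b(1) b(2)[unfolded \<open>q = 3\<close>]
  have a2: "a [^] (2 :: nat) = \<one>" "a \<noteq> \<one>" and b3: "b [^] (3 :: nat) = \<one>" "b \<noteq> \<one>"
    using pow_ord_eq_1[OF a(1)] pow_ord_eq_1[OF b(1)] a b by auto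
  have six: "x [^] (6 :: nat) = \<one>" if x: "x \<in> carrier G" for x
  proof -
    have "ord x dvd 6"
    proof (rule multiplicity_le_imp_dvd)
      show "ord x \<noteq> 0" using ord_pos[OF fin x] by simp
      fix p :: nat assume p: "Factorial_Ring.prime p"
      let ?k = "multiplicity p (ord x)"
      obtain h where h: "h \<in> carrier G" "ord h = p ^ ?k"
        using exists_element_of_order[OF fin x multiplicity_dvd] .
      show "?k \<le> multiplicity p 6"
      proof (cases "?k = 0")
        case False
        then have "1 < p ^ ?k" using prime_gt_1_nat[OF p] by (intro one_less_power) auto
        then have h1: "h \<noteq> \<one>" using h by auto
        have "p ^ ?k dvd 6"
        proof (cases "p = 2")
          case True
          then have "coprime (ord h) (ord b)" using h b by simp
          then have "ord h * ord b = 6" using coprime_order_product_eq_6[OF fin res h(1) h1 b(1) b3(2)] by blast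
          then show ?thesis using h by (metis dvd_triv_left)
        next
          case False
          then have "coprime p 2" using primes_coprime[OF p two_is_prime_nat] by simp
          then have "coprime (ord h) (ord a)" using h a by simp
          then have "ord h * ord a = 6" using coprime_order_product_eq_6[OF fin res h(1) h1 a(1) a2(2)] by blast
          then show ?thesis using h by (metis dvd_triv_left)
        qed
        then show ?thesis using p by (intro multiplicity_geI) (auto simp: prime_nat_iff)
      qed simp
    qed
    then show ?thesis using x pow_eq_id by blast
  qed
  \<comment> \<open>Every element is the product of \<open>x\<^sup>3\<close> and \<open>x\<^sup>4\<close>, whose orders divide \<open>2\<close> and \<open>3\<close>.\<close>
  have split: "x [^] (3 :: nat) \<otimes> x [^] (4 :: nat) = x" if "x \<in> carrier G" for x
    using six[OF that] that nat_pow_mult[OF that, of 6 1] by (simp add: nat_pow_mult)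
  have tors: "(x [^] (3 :: nat)) [^] (2 :: nat) = \<one>" "(x [^] (4 :: nat)) [^] (3 :: nat) = \<one>"
    if "x \<in> carrier G" for x
    using six[OF that] that nat_pow_pow[OF that, of 6 2] by (simp_all add: nat_pow_pow)
  have comm_mult: "(s \<otimes> t) \<otimes> z = z \<otimes> (s \<otimes> t)"
    if "s \<in> carrier G" "t \<in> carrier G" "z \<in> carrier G" "s \<otimes> z = z \<otimes> s" "t \<otimes> z = z \<otimes> t" for s t z
    using that by (metis m_assoc)
  have "x \<otimes> y = y \<otimes> x" if x: "x \<in> carrier G" and y: "y \<in> carrier G" for x y
  proof -
    let ?x2 = "x [^] (3 :: nat)" and ?x3 = "x [^] (4 :: nat)"
    let ?y2 = "y [^] (3 :: nat)" and ?y3 = "y [^] (4 :: nat)"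
    note c = nat_pow_closed[OF x] nat_pow_closed[OF y]
    have "?x2 \<otimes> ?y2 = ?y2 \<otimes> ?x2"
      by (rule same_prime_torsion_commute[OF res c(1) tors(1)[OF x] c(2) tors(1)[OF y] b(1) b3]) simp_all
    moreover have "?x3 \<otimes> ?y3 = ?y3 \<otimes> ?x3"
      by (rule same_prime_torsion_commute[OF res c(1) tors(2)[OF x] c(2) tors(2)[OF y] a(1) a2]) simp_all
    moreover have "?x2 \<otimes> ?y3 = ?y3 \<otimes> ?x2"
      by (rule coprime_torsion_commute[OF res c(1) tors(1)[OF x] c(2) tors(2)[OF y]]) simp
    moreover have "?x3 \<otimes> ?y2 = ?y2 \<otimes> ?x3"
      by (rule coprime_torsion_commute[OF res c(1) tors(2)[OF x] c(2) tors(1)[OF y]]) simp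
    ultimately have "x \<otimes> ?y2 = ?y2 \<otimes> x" "x \<otimes> ?y3 = ?y3 \<otimes> x"
      using comm_mult[of ?x2 ?x3 ?y2] comm_mult[of ?x2 ?x3 ?y3] c by (simp_all only: split[OF x])
    then show ?thesis
      using comm_mult[of ?y2 ?y3 x] c x by (simp only: split[OF y])
  qed
  then have "comm_group G" by (rule group_comm_groupI)
  moreover have "group_exponent G = 6"
    unfolding group_exponent_def
  proof (rule Least_equality)
    show "(6 :: nat) > 0 \<and> (\<forall>x\<in>carrier G. x [^] (6 :: nat) = \<one>)" using six by simp
    fix n :: nat assume n: "n > 0 \<and> (\<forall>x\<in>carrier G. x [^] n = \<one>)"
    then have "2 dvd n" "3 dvd n" using a b pow_eq_id by metis+
    then have "6 dvd n" by presburger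
    then show "6 \<le> n" using n by (auto dest!: dvd_imp_le)
  qed
  ultimately show ?thesis by blast
qed

lemma group_exponent_pow:
  assumes "finite (carrier G)" "x \<in> carrier G"
  shows "x [^] group_exponent G = \<one>"
proof -
  have "Coset.order G > 0 \<and> (\<forall>x\<in>carrier G. x [^] Coset.order G = \<one>)"
    using assms(1) pow_order_eq_1 by (simp add: order_gt_0_iff_finite)
  then have "group_exponent G > 0 \<and> (\<forall>x\<in>carrier G. x [^] group_exponent G = \<one>)"
    unfolding group_exponent_def by (rule LeastI)
  then show ?thesis using assms(2) by blast
qed

end

theorem theorem5:
  fixes G (structure)
  assumes "group G" and "finite (carrier G)"
  shows "delta_adic_residue G = {\<one>\<^bsub>group_ring G\<^esub>} \<longleftrightarrow>
    (comm_group G \<and> group_exponent G = 6) \<or> (\<exists>p. Factorial_Ring.prime p \<and> p_group p G)"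
proof -
  interpret group G by fact
  have "delta_adic_residue G = {frag_of \<one>}" if "comm_group G" "group_exponent G = 6"
    using comm_group.exponent_6_residue_trivial[OF that(1) assms(2)] group_exponent_pow[OF assms(2)] that(2)
    by simp
  then show ?thesis
    using residue_trivial_imp_exponent_6[OF assms(2)] p_group_residue_trivial[OF assms(2)] by auto
qed

end
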